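(* (a) Any isometric triple $(H_{\mathbb R},M,S)$ splits into a direct sum, with $S$-orthogonal and $M$-invariant summands, of irreducible isometric triples. The splitting is unique up to isomorphism. (b) Any Seifert form pair $(H_{\mathbb R},L)$ splits into a direct sum, with $L$-orthogonal summands, of irreducible Seifert form pairs. The splitting is unique up to isomorphism.
   Context: $H_{\mathbb R}$ denotes a finite dimensional real vector space. For a bilinear form $B:H_{\mathbb R}\times H_{\mathbb R}\to\mathbb{R}$, two subspaces $V_1,V_2\subset H_{\mathbb R}$ are $B$-orthogonal if $B(V_1,V_2)=B(V_2,V_1)=0$. An isometric triple is a triple $(H_{\mathbb R},M,S)$ where $M:H_{\mathbb R}\to H_{\mathbb R}$ is an automorphism (called monodromy), $S:H_{\mathbb R}\times H_{\mathbb R}\to\mathbb{R}$ is a nondegenerate bilinear form which is $(-1)^m$-symmetric for some $m\in\{0,1\}$ (i.e. symmetric or antisymmetric), and $M$ is an isometry of $S$, i.e. $S(Ma,Mb)=S(a,b)$ for all $a,b\in H_{\mathbb R}$. It is called irreducible if it is nonzero and $H_{\mathbb R}$ does not split into two $S$-orthogonal and $M$-invariant subspaces which are both $\neq\{0\}$. A Seifert form pair is a pair $(H_{\mathbb R},L)$ where $L:H_{\mathbb R}\times H_{\mathbb R}\to\mathbb{R}$ is a nondegenerate bilinear form (in general neither symmetric nor antisymmetric). It is called irreducible if it is nonzero and $H_{\mathbb R}$ does not split into two $L$-orthogonal subspaces which are both $\neq\{0\}$. Isomorphisms of isometric triples are linear isomorphisms respecting $M$ and $S$; isomorphisms of Seifert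 form pairs are linear isomorphisms respecting $L$. *)

theory Defs
  imports Complex_Main "HOL-Library.FuncSet"
begin

text \<open>
  A finite dimensional real vector space is rendered as a finite dimensional subspace \<open>H\<close> of an
  arbitrary real vector space type (so \<open>H = {0}\<close> is allowed, and a summand of \<open>H\<close> is an object of
  the same kind). Maps and forms are total functions of which only the values on \<open>H\<close> matter;
  restricting them to a summand is therefore just a change of carrier.
\<close>

definition fin_dim_space :: "'a::real_vector set \<Rightarrow> bool" where
  "fin_dim_space H \<longleftrightarrow> subspace H \<and> (\<exists>B. finite B \<and> span B = H)"

definition linear_on :: "'a::real_vector set \<Rightarrow> ('a \<Rightarrow> 'b::real_vector) \<Rightarrow> bool" where
  "linear_on H f \<longleftrightarrow>
     (\<forall>x\<in>H. \<forall>y\<in>H. f (x + y) = f x + f y) \<and> (\<forall>c. \<forall>x\<in>H. f (c *\<^sub>R x) = c *\<^sub>R f x)"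

definition bilinear_form_on :: "'a::real_vector set \<Rightarrow> ('a \<Rightarrow> 'a \<Rightarrow> real) \<Rightarrow> bool" where
  "bilinear_form_on H B \<longleftrightarrow>
     (\<forall>x\<in>H. linear_on H (\<lambda>y. B x y)) \<and> (\<forall>y\<in>H. linear_on H (\<lambda>x. B x y))"

definition nondegenerate_on :: "'a::real_vector set \<Rightarrow> ('a \<Rightarrow> 'a \<Rightarrow> real) \<Rightarrow> bool" where
  "nondegenerate_on H B \<longleftrightarrow>
     (\<forall>x\<in>H. (\<forall>y\<in>H. B x y = 0) \<longrightarrow> x = 0) \<and> (\<forall>y\<in>H. (\<forall>x\<in>H. B x y = 0) \<longrightarrow> y = 0)"

definition orthogonal_wrt :: "('a \<Rightarrow> 'a \<Rightarrow> real) \<Rightarrow> 'a set \<Rightarrow> 'a set \<Rightarrow> bool" where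
  "orthogonal_wrt B V1 V2 \<longleftrightarrow> (\<forall>x\<in>V1. \<forall>y\<in>V2. B x y = 0 \<and> B y x = 0)"

definition isometric_triple ::
    "'a::real_vector set \<Rightarrow> ('a \<Rightarrow> 'a) \<Rightarrow> ('a \<Rightarrow> 'a \<Rightarrow> real) \<Rightarrow> bool" where
  "isometric_triple H M S \<longleftrightarrow>
     fin_dim_space H \<and>
     linear_on H M \<and> bij_betw M H H \<and>
     bilinear_form_on H S \<and> nondegenerate_on H S \<and>
     (\<exists>m\<in>{0, 1::nat}. \<forall>a\<in>H. \<forall>b\<in>H. S b a = (-1) ^ m * S a b) \<and>
     (\<forall>a\<in>H. \<forall>b\<in>H. S (M a) (M b) = S a b)"

definition seifert_form_pair :: "'a::real_vector set \<Rightarrow> ('a \<Rightarrow> 'a \<Rightarrow> real) \<Rightarrow> bool" where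
  "seifert_form_pair H L \<longleftrightarrow>
     fin_dim_space H \<and> bilinear_form_on H L \<and> nondegenerate_on H L"

definition direct_sum2 :: "'a::real_vector set \<Rightarrow> 'a set \<Rightarrow> 'a set \<Rightarrow> bool" where
  "direct_sum2 H V1 V2 \<longleftrightarrow>
     subspace V1 \<and> subspace V2 \<and> V1 \<inter> V2 = {0} \<and> H = {x + y |x y. x \<in> V1 \<and> y \<in> V2}"

definition irreducible_isometric_triple ::
    "'a::real_vector set \<Rightarrow> ('a \<Rightarrow> 'a) \<Rightarrow> ('a \<Rightarrow> 'a \<Rightarrow> real) \<Rightarrow> bool" where
  "irreducible_isometric_triple H M S \<longleftrightarrow>
     isometric_triple H M S \<and> H \<noteq> {0} \<and>
     \<not> (\<exists>V1 V2. direct_sum2 H V1 V2 \<and> orthogonal_wrt S V1 V2 \<and>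
          M ` V1 \<subseteq> V1 \<and> M ` V2 \<subseteq> V2 \<and> V1 \<noteq> {0} \<and> V2 \<noteq> {0})"

definition irreducible_seifert_form_pair ::
    "'a::real_vector set \<Rightarrow> ('a \<Rightarrow> 'a \<Rightarrow> real) \<Rightarrow> bool" where
  "irreducible_seifert_form_pair H L \<longleftrightarrow>
     seifert_form_pair H L \<and> H \<noteq> {0} \<and>
     \<not> (\<exists>V1 V2. direct_sum2 H V1 V2 \<and> orthogonal_wrt L V1 V2 \<and> V1 \<noteq> {0} \<and> V2 \<noteq> {0})"

text \<open>
  \<open>H\<close> is the internal direct sum of the subspaces \<open>V 0, \<dots>, V (n - 1)\<close>: the summation map from the
  product of the \<open>V i\<close> is a bijection onto \<open>H\<close>. For \<open>n = 0\<close> this says \<open>H = {0}\<close>.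
\<close>

definition direct_sum_decomp :: "'a::real_vector set \<Rightarrow> nat \<Rightarrow> (nat \<Rightarrow> 'a set) \<Rightarrow> bool" where
  "direct_sum_decomp H n V \<longleftrightarrow>
     (\<forall>i<n. subspace (V i)) \<and>
     bij_betw (\<lambda>v. \<Sum>i<n. v i) (Pi\<^sub>E {..<n} V) H"

definition irreducible_triple_splitting ::
    "'a::real_vector set \<Rightarrow> ('a \<Rightarrow> 'a) \<Rightarrow> ('a \<Rightarrow> 'a \<Rightarrow> real) \<Rightarrow> nat \<Rightarrow> (nat \<Rightarrow> 'a set) \<Rightarrow> bool" where
  "irreducible_triple_splitting H M S n V \<longleftrightarrow>
     direct_sum_decomp H n V \<and>
     (\<forall>i<n. \<forall>j<n. i \<noteq> j \<longrightarrow> orthogonal_wrt S (V i) (V j)) \<and>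
     (\<forall>i<n. M ` V i \<subseteq> V i) \<and>
     (\<forall>i<n. irreducible_isometric_triple (V i) M S)"

definition irreducible_seifert_splitting ::
    "'a::real_vector set \<Rightarrow> ('a \<Rightarrow> 'a \<Rightarrow> real) \<Rightarrow> nat \<Rightarrow> (nat \<Rightarrow> 'a set) \<Rightarrow> bool" where
  "irreducible_seifert_splitting H L n V \<longleftrightarrow>
     direct_sum_decomp H n V \<and>
     (\<forall>i<n. \<forall>j<n. i \<noteq> j \<longrightarrow> orthogonal_wrt L (V i) (V j)) \<and>
     (\<forall>i<n. irreducible_seifert_form_pair (V i) L)"

definition isometric_triple_iso ::
    "'a::real_vector set \<Rightarrow> ('a \<Rightarrow> 'a) \<Rightarrow> ('a \<Rightarrow> 'a \<Rightarrow> real) \<Rightarrow>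
     'b::real_vector set \<Rightarrow> ('b \<Rightarrow> 'b) \<Rightarrow> ('b \<Rightarrow> 'b \<Rightarrow> real) \<Rightarrow> bool" where
  "isometric_triple_iso H M S H' M' S' \<longleftrightarrow>
     (\<exists>f. linear_on H f \<and> bij_betw f H H' \<and>
          (\<forall>a\<in>H. f (M a) = M' (f a)) \<and>
          (\<forall>a\<in>H. \<forall>b\<in>H. S' (f a) (f b) = S a b))"

definition seifert_form_pair_iso ::
    "'a::real_vector set \<Rightarrow> ('a \<Rightarrow> 'a \<Rightarrow> real) \<Rightarrow>
     'b::real_vector set \<Rightarrow> ('b \<Rightarrow> 'b \<Rightarrow> real) \<Rightarrow> bool" where
  "seifert_form_pair_iso H L H' L' \<longleftrightarrow>
     (\<exists>f. linear_on H f \<and> bij_betw f H H' \<and>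
          (\<forall>a\<in>H. \<forall>b\<in>H. L' (f a) (f b) = L a b))"

end

theory Submission
  imports Defs "HOL-Computational_Algebra.Computational_Algebra" "HOL-Computational_Algebra.Field_as_Ring"
begin

text \<open>
  Both parts are instances of one statement. Consider a finite dimensional space \<open>H\<close> with a
  nondegenerate bilinear form \<open>L\<close> and a linear endomorphism \<open>M\<close>, and split \<open>H\<close> into
  \<open>M\<close>-invariant subspaces that are \<open>L\<close>-orthogonal on both sides. Isometric triples are of this kind, and
  a Seifert form pair is the case \<open>M = id\<close>.

  Existence is an induction on the dimension. For uniqueness, two-term splittings correspond to
  idempotents \<open>e\<close> that commute with \<open>M\<close> and are symmetric, that is \<open>L (e x) y = L x (e y)\<close>;
  polynomials in a symmetric operator are again symmetric. Three facts carry the proof.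

  A symmetric operator on an irreducible space has at most one real eigenvalue: two of them would, by
  Bezout, give a nontrivial symmetric idempotent that is a polynomial in the operator
  (\<open>irreducible_eigenvalue_unique\<close>).

  An operator \<open>T\<close> of a finite dimensional real space without eigenvalues in \<open>(-\<infinity>, 0]\<close> has a
  square root that is a polynomial in \<open>T\<close> (\<open>poly_op_sqrt\<close>), because the indeterminate is a square
  modulo every real polynomial without roots in \<open>(-\<infinity>, 0]\<close> (\<open>sqrt_X_mod\<close>). This is where the
  ground field matters: over the rationals, for example, splittings into irreducibles are not unique.

  If \<open>e\<close>, \<open>d\<close> are symmetric idempotents and \<open>T = 1 - (e - d)\<^sup>2\<close> has no eigenvalue in \<open>(-\<infinity>, 0]\<close>,
  then \<open>w = d e + (1 - d) (1 - e)\<close> satisfies \<open>w\<^sup>* w = T\<close> and \<open>w e = d w\<close>, and \<open>T\<close> commutes with \<open>e\<close>.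
  Hence \<open>w T\<^bsup>-1/2\<^esup>\<close> is an isometry that carries the image of \<open>e\<close> to that of \<open>d\<close>, and the
  complement of the first to the complement of the second (\<open>idempotents_conjugate\<close>). Thus cancellation
  comes for free.

  Now let \<open>V\<close> be an irreducible summand of \<open>H\<close>, with projection \<open>e\<close>, and \<open>H = W \<oplus> Z\<close> another splitting,
  with projection \<open>p\<close> to \<open>W\<close>. The operators \<open>e p\<close> and \<open>e (1 - p)\<close> of \<open>V\<close> are symmetric with sum \<open>1\<close>. If
  both had an eigenvalue in \<open>(-\<infinity>, 0]\<close>, then \<open>e p\<close> would have one that is \<open>\<le> 0\<close> and one that is
  \<open>\<ge> 1\<close>. So one of them, say \<open>a = e p\<close>, has none, and \<open>d = p a\<^bsup>-1\<^esup> e p\<close> is a symmetric idempotent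
  with image in \<open>W\<close> that is conjugate to \<open>e\<close>. So some isometry of \<open>H\<close> moves \<open>V\<close> into \<open>W\<close> or into \<open>Z\<close>
  (\<open>move_irreducible_into_summand\<close>). By induction, \<open>V\<close> can be moved onto a member of any given
  irreducible splitting (\<open>move_irreducible_onto_member\<close>); the complements follow, and an induction
  on the number of summands finishes the proof (\<open>irreducible_family_unique\<close>).
\<close>


section \<open>Square roots of the indeterminate modulo a real polynomial\<close>

lemma real_poly_bezout:
  fixes p q :: "real poly"
  assumes "coprime p q"
  obtains a b where "a * p + b * q = 1"
proof -
  have "fst (bezout_coefficients p q) * p + snd (bezout_coefficients p q) * q = gcd p q"
    by (rule bezout_coefficients_fst_snd)
  with assms that show thesis by auto
qed

lemma poly_of_real_add:
  "poly (map_poly of_real (p + q)) z = poly (map_poly of_real p) z + poly (map_poly of_real q) (z :: complex)"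
proof -
  have "map_poly of_real (p + q) = map_poly of_real p + (map_poly of_real q :: complex poly)"
    by (rule poly_eqI) (simp add: coeff_map_poly)
  then show ?thesis by simp
qed

lemma poly_of_real_mult:
  "poly (map_poly of_real (p * q)) z = poly (map_poly of_real p) z * poly (map_poly of_real q) (z :: complex)"
proof (induction p)
  case (pCons a p)
  have "map_poly of_real (smult a q) = smult (of_real a) (map_poly of_real q :: complex poly)"
    by (rule poly_eqI) (simp add: coeff_map_poly)
  then show ?case using pCons by (simp add: poly_of_real_add map_poly_pCons algebra_simps)
qed simp

text \<open>
  If no nonzero real polynomial of degree below that of \<open>q\<close> vanishes at the root \<open>z\<close> of \<open>q\<close>, then \<open>q\<close> is
  the minimal polynomial of \<open>z\<close> over the reals up to a factor, so it divides whatever vanishes at \<open>z\<close>.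
\<close>

lemma real_poly_low_degree_dvd:
  fixes m q :: "real poly" and z :: complex
  assumes m: "poly (map_poly of_real m) z = 0" and q: "poly (map_poly of_real q) z = 0"
    and q0: "q \<noteq> 0" and low: "\<And>r. degree r < degree q \<Longrightarrow> poly (map_poly of_real r) z = 0 \<Longrightarrow> r = 0"
  shows "q dvd m"
proof -
  have "poly (map_poly of_real m) z = poly (map_poly of_real q) z * poly (map_poly of_real (m div q)) z
      + poly (map_poly of_real (m mod q)) z"
    by (simp flip: poly_of_real_mult poly_of_real_add)
  then have "poly (map_poly of_real (m mod q)) z = 0" using m q by simp
  moreover have "m mod q = 0 \<or> degree (m mod q) < degree q" using degree_mod_less[OF q0] .
  ultimately have "m mod q = 0" using low by blast
  then show ?thesis by (simp add: mod_eq_0_iff_dvd)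
qed

lemma real_poly_factor_cases:
  fixes m :: "real poly"
  assumes "degree m > 0"
  obtains (linear) a where "[:-a, 1:] dvd m"
    | (quadratic) b c where "c > b\<^sup>2" "[:c, - 2 * b, 1:] dvd m"
proof -
  have "degree (map_poly of_real m :: complex poly) > 0" using assms by (simp add: degree_map_poly)
  then obtain z :: complex where z: "poly (map_poly of_real m) z = 0"
    using alg_closed_imp_poly_has_root by blast
  show thesis
  proof (cases "Im z = 0")
    case True
    then have "z = of_real (Re z)" by (simp add: complex_eq_iff)
    then have "poly (map_poly of_real m) (of_real (Re z) :: complex) = 0" using z by metis
    moreover have "poly (map_poly of_real m) (of_real (Re z)) = (of_real (poly m (Re z)) :: complex)"
      by (induction m) (simp_all add: map_poly_pCons)
    ultimately have "poly m (Re z) = 0" by (metis of_real_eq_0_iff)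
    then show thesis using linear poly_eq_0_iff_dvd by blast
  next
    case False
    let ?q = "[:(Re z)\<^sup>2 + (Im z)\<^sup>2, - 2 * Re z, 1:]"
    have "?q dvd m"
    proof (rule real_poly_low_degree_dvd[OF z])
      show "poly (map_poly of_real ?q) z = 0"
        by (simp add: map_poly_pCons complex_eq_iff power2_eq_square algebra_simps)
      fix r :: "real poly"
      assume "degree r < degree ?q" and r: "poly (map_poly of_real r) z = 0"
      then have "degree r \<le> 1" by simp
      then obtain u v where uv: "r = [:u, v:]" 
        by (metis One_nat_def degree_pCons_eq_if le_SucE le_0_eq degree_eq_zeroE pCons_cases Suc_inject Zero_not_Suc pCons_0_0)
      then show "r = 0" using r False by (auto simp: map_poly_pCons complex_eq_iff)
    qed simp
    then show thesis using False by (intro quadratic[of "Re z" "(Re z)\<^sup>2 + (Im z)\<^sup>2"]) auto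
  qed
qed

text \<open>
  Constant factors of \<open>q\<close> do not matter. A linear \<open>q\<close> has a positive root \<open>a\<close>, and \<open>X\<close> is congruent to the square of \<open>sqrt a\<close>. A quadratic
  \<open>q = X\<^sup>2 - 2 b X + c\<close> has \<open>sqrt c > \<bar>b\<bar>\<close>, and \<open>(X + sqrt c)\<^sup>2 = q + 2 (sqrt c + b) X\<close> shows that a
  positive multiple of \<open>X\<close> is a square.
\<close>

lemma sqrt_X_mod_irreducible:
  fixes q :: "real poly"
  assumes "irreducible q" and root: "\<And>x. x \<le> 0 \<Longrightarrow> poly q x \<noteq> 0"
  shows "\<exists>s. q dvd s * s - [:0, 1:]"
proof -
  have deg: "degree q > 0"
    using assms(1) by (metis irreducible_def is_unit_iff_degree gr0I)
  have irr: "q dvd f" if "f dvd q" "degree f > 0" for f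
    using irreducibleD'[OF assms(1) that(1)] that(2) by (auto simp: is_unit_poly_iff)
  from deg show ?thesis
  proof (cases rule: real_poly_factor_cases)
    case (linear a)
    then have "poly q a = 0" by (simp add: poly_eq_0_iff_dvd)
    then have a: "a > 0" using root[of a] by force
    have "q dvd [:-a, 1:]" by (rule irr[OF linear]) simp
    moreover have "[:sqrt a:] * [:sqrt a:] - [:0, 1:] = - [:-a, 1:]" using a by simp
    ultimately show ?thesis by (metis dvd_minus_iff)
  next
    case (quadratic b c)
    define d where "d = 2 * (sqrt c + b)"
    have "\<bar>b\<bar> < sqrt c" using quadratic(1) by (rule real_less_rsqrt[of "\<bar>b\<bar>", simplified])
    then have d: "d > 0" unfolding d_def by (simp add: abs_less_iff)
    have c: "c > 0" using quadratic(1) by (meson le_less_trans zero_le_power2)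
    have "q dvd [:c, - 2 * b, 1:]" by (rule irr[OF quadratic(2)]) simp
    moreover have "smult (1 / sqrt d) [:sqrt c, 1:] * smult (1 / sqrt d) [:sqrt c, 1:] - [:0, 1:]
        = smult (1 / d) [:c, - 2 * b, 1:]"
    proof -
      have "[:sqrt c, 1:] * [:sqrt c, 1:] = [:c, - 2 * b, 1:] + smult d [:0, 1:]"
        using c by (simp add: d_def)
      moreover have "1 / sqrt d * (1 / sqrt d) = 1 / d" using d by (simp add: field_simps)
      ultimately show ?thesis using d
        by (simp only: mult_smult_left mult_smult_right smult_smult smult_add_right) simp
    qed
    ultimately show ?thesis by (metis dvd_smult)
  qed
qed

text \<open>
  Split off one irreducible factor \<open>q\<close> at a time, \<open>m = q * n\<close>. If \<open>q\<close> divides \<open>n\<close>, a root modulo \<open>n\<close>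
  is improved by Newton's step as in Hensel's lemma; otherwise the roots modulo \<open>q\<close> and modulo \<open>n\<close>
  are glued by the Chinese remainder theorem.
\<close>

lemma sqrt_X_mod:
  fixes m :: "real poly"
  assumes "m \<noteq> 0" and "\<And>x. x \<le> 0 \<Longrightarrow> poly m x \<noteq> 0"
  shows "\<exists>p. m dvd p * p - [:0, 1:]"
  using assms
proof (induction "degree m" arbitrary: m rule: less_induct)
  case less
  show ?case
  proof (cases "is_unit m")
    case True
    then show ?thesis using unit_imp_dvd by blast
  next
    case False
    obtain q where q: "q dvd m" "prime q" using prime_divisor_exists[OF less.prems(1) False] by blast
    then have irr: "irreducible q" and pe: "prime_elem q"
      by (simp_all add: prime_elem_imp_irreducible)
    obtain n where m: "m = q * n" using q(1) by blast
    have degq: "degree q > 0" using irr by (metis irreducible_def is_unit_iff_degree gr0I)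
    have nz: "q \<noteq> 0" "n \<noteq> 0" using less.prems(1) m by auto
    have deg: "degree n < degree m" using m nz degq by (simp add: degree_mult_eq)
    have rq: "poly q x \<noteq> 0" and rn: "poly n x \<noteq> 0" if "x \<le> 0" for x
      using less.prems(2)[OF that] m by auto
    obtain p where p: "n dvd p * p - [:0, 1:]" using less.hyps[OF deg nz(2) rn] by blast
    show ?thesis
    proof (cases "q dvd n")
      case True
      \<comment> \<open>The derivative \<open>2 p\<close> of the equation must be a unit modulo \<open>q\<close>; it is, since \<open>q\<close> does not
        divide \<open>X\<close>.\<close>
      have "\<not> q dvd p"
      proof
        assume "q dvd p"
        then have "q dvd p * p - (p * p - [:0, 1:])"
          using dvd_trans[OF True p] by (meson dvd_diff dvd_mult2)
        then have "q dvd [:0, 1:]" by simp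
        then obtain k where k: "[:0, 1:] = q * k" by blast
        have nz': "k \<noteq> 0" using k by force
        then have "degree q + degree k = 1" using k nz(1) by (metis degree_mult_eq degree_pCons_eq_if one_neq_zero One_nat_def degree_0 pCons_eq_0_iff)
        then have "degree k = 0" using degq by simp
        then obtain c where c: "k = [:c:]" by (rule degree_eq_zeroE)
        have "poly q 0 * c = poly [:0, 1:] 0" unfolding k c by simp
        then have "poly q 0 = 0" using nz' c by simp
        then show False using rq[of 0] by simp
      qed
      moreover have "\<not> q dvd [:2:]" using degq dvd_imp_degree_le[of q "[:2:]"] by auto
      ultimately have "\<not> q dvd [:2:] * p" using prime_elem_dvd_mult_iff[OF pe] by blast
      then obtain a b where ab: "a * q + b * ([:2:] * p) = 1"
        using prime_elem_imp_coprime[OF pe] real_poly_bezout by blast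
      obtain r where r: "p * p - [:0, 1:] = n * r" using p by blast
      obtain n' where n': "n = q * n'" using True by blast
      define t where "t = - (b * r)"
      have "(p + n * t) * (p + n * t) - [:0, 1:] = n * r + n * ([:2:] * p * t + n * t * t)"
        unfolding r[symmetric] by (simp add: algebra_simps flip: mult_2) (simp add: numeral_poly algebra_simps)
      also have "\<dots> = n * (r * (a * q + b * ([:2:] * p)) + [:2:] * p * t + n * t * t)"
        unfolding ab by (simp add: algebra_simps)
      also have "\<dots> = q * n * (r * a + n' * t * t)"
        unfolding t_def by (subst (2) n') (simp add: algebra_simps n')
      finally show ?thesis unfolding m by (metis dvd_triv_left)
    next
      case False
      have cop: "coprime q n" using prime_elem_imp_coprime[OF pe False] .
      then obtain a b where ab: "a * q + b * n = 1" using real_poly_bezout by blast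
      obtain s where s: "q dvd s * s - [:0, 1:]" using sqrt_X_mod_irreducible[OF irr rq] by blast
      \<comment> \<open>The factors \<open>a * q\<close> and \<open>b * n\<close> are the idempotents of the Chinese remainder theorem.\<close>
      define x where "x = p * (a * q) + s * (b * n)"
      have 1: "x = p + n * (b * (s - p))"
      proof -
        have "x = p * (a * q + b * n) + n * (b * (s - p))" unfolding x_def by (simp add: algebra_simps)
        then show ?thesis by (simp add: ab)
      qed
      have 2: "x = s + q * (a * (p - s))"
      proof -
        have "x = s * (a * q + b * n) + q * (a * (p - s))" unfolding x_def by (simp add: algebra_simps)
        then show ?thesis by (simp add: ab)
      qed
      have lift: "d dvd (y + d * e) * (y + d * e) - [:0, 1:]" if "d dvd y * y - [:0, 1:]" for d y e :: "real poly"
      proof -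
        have "(y + d * e) * (y + d * e) - [:0, 1:] = (y * y - [:0, 1:]) + d * (2 * y * e + d * e * e)"
          by (simp add: algebra_simps)
        then show ?thesis using that by (metis dvd_add dvd_triv_left)
      qed
      have "q * n dvd x * x - [:0, 1:]"
        using divides_mult[OF _ _ cop] lift[OF p] lift[OF s] 1 2 by metis
      then show ?thesis unfolding m by blast
    qed
  qed
qed


section \<open>Polynomials in a linear operator\<close>

definition poly_op :: "('a::real_vector \<Rightarrow> 'a) \<Rightarrow> real poly \<Rightarrow> 'a \<Rightarrow> 'a" where
  "poly_op T p x = (\<Sum>i\<le>degree p. coeff p i *\<^sub>R (T ^^ i) x)"

lemma poly_op_bound:
  assumes "degree p \<le> n"
  shows "poly_op T p x = (\<Sum>i\<le>n. coeff p i *\<^sub>R (T ^^ i) x)"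
  unfolding poly_op_def using assms
  by (intro sum.mono_neutral_left) (auto simp: coeff_eq_0)

lemma poly_op_add: "poly_op T (p + q) x = poly_op T p x + poly_op T q x"
proof -
  define n where "n = max (degree p) (degree q)"
  have "degree p \<le> n" "degree q \<le> n" "degree (p + q) \<le> n"
    unfolding n_def by (auto intro: degree_add_le_max)
  then show ?thesis by (simp add: poly_op_bound[of _ n] scaleR_add_left sum.distrib)
qed

lemma poly_op_smult: "poly_op T (smult c p) x = c *\<^sub>R poly_op T p x"
  by (subst poly_op_bound[OF degree_smult_le]) (simp add: poly_op_def scaleR_sum_right)

lemma poly_op_0 [simp]: "poly_op T 0 x = 0"
  by (simp add: poly_op_def)

lemma poly_op_diff: "poly_op T (p - q) x = poly_op T p x - poly_op T q x"
  using poly_op_add[of T p "- q" x] poly_op_smult[of T "-1" q x] by simp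

context
  fixes T :: "'a::real_vector \<Rightarrow> 'a"
  assumes T: "linear T"
begin

lemma poly_op_pCons [simp]: "poly_op T (pCons c p) x = c *\<^sub>R x + T (poly_op T p x)"
proof -
  have "poly_op T (pCons c p) x = (\<Sum>i\<le>Suc (degree p). coeff (pCons c p) i *\<^sub>R (T ^^ i) x)"
    by (intro poly_op_bound degree_pCons_le)
  also have "\<dots> = c *\<^sub>R x + (\<Sum>i\<le>degree p. T (coeff p i *\<^sub>R (T ^^ i) x))"
    by (simp add: sum.atMost_Suc_shift linear_scale[OF T] del: sum.atMost_Suc)
  finally show ?thesis by (simp add: poly_op_def linear_sum[OF T])
qed

lemma poly_op_linear: "linear (poly_op T p)"
proof (induction p)
  case 0
  then show ?case by (simp add: linear_iff)
next
  case (pCons c p)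
  then show ?case by (simp add: linear_iff linear_add[OF T] linear_scale[OF T] algebra_simps)
qed

lemma poly_op_mult: "poly_op T (p * q) x = poly_op T p (poly_op T q x)"
  by (induction p) (simp_all add: poly_op_add poly_op_smult)


lemma poly_op_invariant:
  assumes "subspace H" "T ` H \<subseteq> H" "x \<in> H"
  shows "poly_op T p x \<in> H"
  using assms by (induction p) (auto simp: subspace_0 subspace_add subspace_scale)

lemma poly_op_commute:
  assumes H: "subspace H" "T ` H \<subseteq> H" and A: "linear_on H A"
    and TA: "\<And>x. x \<in> H \<Longrightarrow> T (A x) = A (T x)" and x: "x \<in> H"
  shows "poly_op T p (A x) = A (poly_op T p x)"
proof (induction p)
  case 0
  have "A 0 = A (0 *\<^sub>R 0)" by simp
  also have "\<dots> = 0" using A subspace_0[OF H(1)] unfolding linear_on_def by (metis scaleR_zero_left)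
  finally show ?case by simp
next
  case (pCons c p)
  have "poly_op T p x \<in> H" "T (poly_op T p x) \<in> H"
    using poly_op_invariant[OF H x] H(2) by auto
  then show ?case using A x H(1) TA pCons by (simp add: linear_on_def subspace_scale)
qed

lemma poly_op_eigenvector:
  assumes "T x = c *\<^sub>R x"
  shows "poly_op T p x = poly p c *\<^sub>R x"
  by (induction p) (simp_all add: linear_scale[OF T] assms algebra_simps)

lemma poly_op_dvd:
  assumes "m dvd p" "poly_op T m x = 0"
  shows "poly_op T p x = 0"
  using assms by (auto simp: poly_op_mult mult.commute[of m] linear_0[OF poly_op_linear] elim!: dvdE)

text \<open>
  The iterates \<open>x, T x, \<dots>, T\<^bsup>n\<^esup> x\<close> with \<open>n = card B\<close> are too many to be linearly independent.
\<close>

lemma annihilating_poly_vector: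
  assumes "finite B" "T ` span B \<subseteq> span B" "x \<in> span B"
  obtains m where "m \<noteq> 0" "poly_op T m x = 0"
proof -
  define n where "n = card B"
  define v where "v i = (T ^^ i) x" for i
  have v: "v i \<in> span B" for i unfolding v_def using assms(2,3) by (induction i) auto
  have "\<exists>c. (\<exists>i\<le>n. c i \<noteq> (0::real)) \<and> (\<Sum>i\<le>n. c i *\<^sub>R v i) = 0"
  proof (cases "inj_on v {..n}")
    case True
    have "\<not> independent (v ` {..n})"
    proof
      assume "independent (v ` {..n})"
      then have "card (v ` {..n}) \<le> card B"
        using independent_span_bound[OF assms(1)] v by blast
      then show False using card_image[OF True] by (simp add: n_def)
    qed
    then obtain u where u: "\<exists>w\<in>v ` {..n}. u w \<noteq> 0" "(\<Sum>w\<in>v ` {..n}. u w *\<^sub>R w) = 0"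
      unfolding dependent_finite[OF finite_imageI[OF finite_atMost]] by blast
    then have "(\<Sum>i\<le>n. u (v i) *\<^sub>R v i) = 0" by (simp add: sum.reindex[OF True])
    moreover have "\<exists>i\<le>n. u (v i) \<noteq> 0" using u(1) by blast
    ultimately show ?thesis by (intro exI[of _ "\<lambda>i. u (v i)"] conjI)
  next
    case False
    then obtain i j where ij: "i \<le> n" "j \<le> n" "i \<noteq> j" "v i = v j" by (auto simp: inj_on_def)
    have "(\<Sum>k\<le>n. (if k = i then 1 else if k = j then -1 else 0) *\<^sub>R v k)
        = (\<Sum>k\<le>n. (if k = i then v k else 0) - (if k = j then v k else 0))"
      using ij by (intro sum.cong) auto
    also have "\<dots> = 0" using ij by (simp add: sum_subtractf)
    finally show ?thesis
      using ij(1) by (intro exI[of _ "\<lambda>k. if k = i then 1 else if k = j then -1 else 0"] conjI exI[of _ i]) simp_all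
  qed
  then obtain c where c: "\<exists>i\<le>n. c i \<noteq> 0" "(\<Sum>i\<le>n. c i *\<^sub>R v i) = 0" by blast
  define m where "m = (\<Sum>i\<le>n. monom (c i) i)"
  have cm: "coeff m i = (if i \<le> n then c i else 0)" for i
    unfolding m_def by (simp add: coeff_sum)
  have "degree m \<le> n" unfolding m_def by (intro degree_sum_le) (auto intro: order_trans[OF degree_monom_le])
  then have "poly_op T m x = 0" using c(2) by (simp add: poly_op_bound cm v_def)
  moreover have "m \<noteq> 0" using c(1) cm by (metis coeff_0)
  ultimately show thesis using that by blast
qed

text \<open>
  The product of annihilators of the generators kills the span.
\<close>

lemma annihilating_poly:
  assumes "finite B" "T ` span B \<subseteq> span B"
  obtains m where "m \<noteq> 0" "\<And>x. x \<in> span B \<Longrightarrow> poly_op T m x = 0"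
proof -
  have "\<exists>m. m \<noteq> 0 \<and> poly_op T m b = 0" if "b \<in> B" for b
    using annihilating_poly_vector[OF assms span_base[OF that]] by blast
  then obtain f where f: "\<And>b. b \<in> B \<Longrightarrow> f b \<noteq> 0 \<and> poly_op T (f b) b = 0" by metis
  define m where "m = prod f B"
  have "poly_op T m b = 0" if "b \<in> B" for b
    using poly_op_dvd[of "f b" m b] f[OF that] dvd_prodI[OF assms(1) that, of f] by (simp add: m_def)
  then have "poly_op T m x = 0" if "x \<in> span B" for x
    using linear_eq_0_on_span[OF poly_op_linear _ that] by blast
  moreover have "m \<noteq> 0" using assms(1) f by (simp add: m_def)
  ultimately show thesis using that by blast
qed

text \<open>
  An annihilator of least degree has only eigenvalues as its real roots: dividing out the factor of a
  root leaves a polynomial in \<open>T\<close> that does not vanish, and its nonzero values are eigenvectors.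
\<close>

lemma minimal_poly:
  assumes "fin_dim_space H" "T ` H \<subseteq> H"
  obtains m where "m \<noteq> 0" "\<And>x. x \<in> H \<Longrightarrow> poly_op T m x = 0"
    "\<And>c. poly m c = 0 \<Longrightarrow> \<exists>x\<in>H. x \<noteq> 0 \<and> T x = c *\<^sub>R x"
proof -
  let ?P = "\<lambda>m. m \<noteq> 0 \<and> (\<forall>x\<in>H. poly_op T m x = 0)"
  obtain B where B: "finite B" "span B = H" using assms(1) unfolding fin_dim_space_def by blast
  have "\<exists>m. ?P m" using annihilating_poly[OF B(1)] assms(2) B(2) by metis
  then obtain m where m: "?P m" "\<And>k. ?P k \<Longrightarrow> degree m \<le> degree k"
    using ex_has_least_nat[of ?P _ degree] by metis
  show thesis
  proof
    show "m \<noteq> 0" using m by blast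
    show "poly_op T m x = 0" if "x \<in> H" for x using m(1) that by blast
    fix c assume "poly m c = 0"
    then obtain k where k: "m = [:-c, 1:] * k" by (metis poly_eq_0_iff_dvd dvdE)
    then have "k \<noteq> 0" using m(1) by auto
    moreover have "degree m = Suc (degree k)" unfolding k using \<open>k \<noteq> 0\<close> by (simp add: degree_mult_eq del: mult_pCons_left)
    ultimately obtain x where x: "x \<in> H" "poly_op T k x \<noteq> 0" using m(2)[of k] by auto
    have "poly_op T [:-c, 1:] (poly_op T k x) = 0"
      using m(1) x(1) unfolding k poly_op_mult by blast
    then have "T (poly_op T k x) = c *\<^sub>R poly_op T k x" by (simp add: linear_0[OF T])
    moreover have "poly_op T k x \<in> H"
      using x(1) assms poly_op_invariant by (auto simp: fin_dim_space_def)
    ultimately show "\<exists>x\<in>H. x \<noteq> 0 \<and> T x = c *\<^sub>R x" using x(2) by blast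
  qed
qed

text \<open>
  The minimal polynomial has nonzero constant term \<open>c\<close>, so \<open>c = - T k(T)\<close> for some polynomial \<open>k\<close>.
  Getting the inverse as a polynomial in \<open>T\<close> makes it inherit symmetry and commutation from \<open>T\<close>.
\<close>

lemma poly_op_inverse:
  assumes "fin_dim_space H" "T ` H \<subseteq> H" "\<And>x. x \<in> H \<Longrightarrow> T x = 0 \<Longrightarrow> x = 0"
  obtains q where "\<And>x. x \<in> H \<Longrightarrow> T (poly_op T q x) = x" "\<And>x. x \<in> H \<Longrightarrow> poly_op T q (T x) = x"
proof -
  obtain m where m: "\<And>x. x \<in> H \<Longrightarrow> poly_op T m x = 0" "poly m 0 \<noteq> 0"
    using minimal_poly[OF assms(1,2)] assms(3) by (metis scaleR_zero_left)
  obtain c k where k: "m = pCons c k" by (rule pCons_cases)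
  have c: "c \<noteq> 0" using m(2) k by simp
  define q where "q = smult (-1 / c) k"
  have *: "T (poly_op T q x) = x" if "x \<in> H" for x
  proof -
    have "T (poly_op T k x) = - c *\<^sub>R x" using m(1)[OF that] k by (simp add: eq_neg_iff_add_eq_0 add.commute)
    then show ?thesis using c by (simp add: q_def poly_op_smult linear_scale[OF T] linear_neg[OF T] del: smult_minus_left)
  qed
  moreover have "poly_op T q (T x) = T (poly_op T q x)" for x
    by (rule poly_op_commute[of UNIV]) (auto simp: linear_on_def linear_add[OF T] linear_scale[OF T])
  ultimately show thesis using that by metis
qed

text \<open>
  The minimal polynomial of \<open>T\<close> has no root in \<open>(-\<infinity>, 0]\<close>; a square root of \<open>X\<close> modulo it is evaluated
  at \<open>T\<close>.
\<close>

lemma poly_op_sqrt: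
  assumes "fin_dim_space H" "T ` H \<subseteq> H" "\<And>x c. x \<in> H \<Longrightarrow> T x = c *\<^sub>R x \<Longrightarrow> c \<le> 0 \<Longrightarrow> x = 0"
  shows "\<exists>p. \<forall>x\<in>H. poly_op T p (poly_op T p x) = T x"
proof -
  obtain m where m: "m \<noteq> 0" "\<And>x. x \<in> H \<Longrightarrow> poly_op T m x = 0" "\<And>c. c \<le> 0 \<Longrightarrow> poly m c \<noteq> 0"
    using minimal_poly[OF assms(1,2)] assms(3) by metis
  obtain p where p: "m dvd p * p - [:0, 1:]" using sqrt_X_mod[OF m(1,3)] by blast
  have "poly_op T p (poly_op T p x) = T x" if "x \<in> H" for x
    using poly_op_dvd[OF p m(2)[OF that]] by (simp add: poly_op_diff poly_op_mult linear_0[OF T])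
  then show ?thesis by blast
qed

end


section \<open>Forms with a commuting operator\<close>

text \<open>
  The common generalisation of isometric triples and of Seifert form pairs; the latter have the identity
  as \<open>M\<close>.
\<close>

definition form_module :: "'a::real_vector set \<Rightarrow> ('a \<Rightarrow> 'a) \<Rightarrow> ('a \<Rightarrow> 'a \<Rightarrow> real) \<Rightarrow> bool" where
  "form_module H M L \<longleftrightarrow> fin_dim_space H \<and> linear_on H M \<and> M ` H \<subseteq> H \<and>
     bilinear_form_on H L \<and> nondegenerate_on H L"

definition orthogonal_split ::
    "'a::real_vector set \<Rightarrow> ('a \<Rightarrow> 'a) \<Rightarrow> ('a \<Rightarrow> 'a \<Rightarrow> real) \<Rightarrow> 'a set \<Rightarrow> 'a set \<Rightarrow> bool" where
  "orthogonal_split H M L V U \<longleftrightarrow> direct_sum2 H V U \<and> orthogonal_wrt L V U \<and> M ` V \<subseteq> V \<and> M ` U \<subseteq> U"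

definition irreducible_form_module ::
    "'a::real_vector set \<Rightarrow> ('a \<Rightarrow> 'a) \<Rightarrow> ('a \<Rightarrow> 'a \<Rightarrow> real) \<Rightarrow> bool" where
  "irreducible_form_module H M L \<longleftrightarrow> form_module H M L \<and> H \<noteq> {0} \<and>
     (\<forall>V U. orthogonal_split H M L V U \<longrightarrow> V = {0} \<or> U = {0})"

text \<open>
  Operators are taken to be linear on the whole type wherever possible, so that the library of linear
  maps applies; this costs nothing because \<open>H\<close> is the image of a linear projection.
\<close>

lemma linear_on_extend:
  assumes "subspace H" "linear_on H f"
  obtains g where "linear g" "\<And>x. x \<in> H \<Longrightarrow> g x = f x"
proof -
  obtain p :: "'a \<Rightarrow> 'a" where p: "linear p" "range p \<subseteq> H" "\<And>x. x \<in> H \<Longrightarrow> p x = x"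
    using linear_exists_left_inverse_on[OF linear_id assms(1)] by (auto simp: id_def)
  have "linear (\<lambda>x. f (p x))"
    using assms(2) p(2) unfolding linear_on_def
    by (auto simp: linear_iff linear_add[OF p(1)] linear_scale[OF p(1)] subset_iff)
  then show thesis using p(3) that by simp
qed

lemma linear_on_subset: "linear_on H f \<Longrightarrow> V \<subseteq> H \<Longrightarrow> linear_on V f"
  unfolding linear_on_def by blast

lemma linear_on_linear: "linear f \<Longrightarrow> linear_on H f"
  by (simp add: linear_on_def linear_add linear_scale)

lemma linear_on_0: "subspace H \<Longrightarrow> linear_on H f \<Longrightarrow> f 0 = 0"
  unfolding linear_on_def by (metis scaleR_zero_left subspace_0)

lemma linear_on_diff:
  assumes "subspace H" "linear_on H f" "x \<in> H" "y \<in> H"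
  shows "f (x - y) = f x - f y"
proof -
  obtain g where g: "linear g" "\<And>x. x \<in> H \<Longrightarrow> g x = f x" using linear_on_extend[OF assms(1,2)] by blast
  have "g (x - y) = g x - g y" by (rule linear_diff[OF g(1)])
  then show ?thesis using g(2) assms(3,4) subspace_diff[OF assms(1,3,4)] by simp
qed

text \<open>
  The inverse is a polynomial in the endomorphism, by \<open>poly_op_inverse\<close>.
\<close>

lemma injective_endomorphism_bij:
  assumes H: "fin_dim_space H" and f: "linear_on H f" "f ` H \<subseteq> H" and inj: "\<And>x. x \<in> H \<Longrightarrow> f x = 0 \<Longrightarrow> x = 0"
  shows "bij_betw f H H"
proof -
  have sub: "subspace H" using H by (simp add: fin_dim_space_def)
  obtain g where g: "linear g" "\<And>x. x \<in> H \<Longrightarrow> g x = f x" using linear_on_extend[OF sub f(1)] by blast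
  have gH: "g ` H \<subseteq> H" using f(2) g(2) by auto
  obtain q where q: "\<And>x. x \<in> H \<Longrightarrow> g (poly_op g q x) = x" "\<And>x. x \<in> H \<Longrightarrow> poly_op g q (g x) = x"
    using poly_op_inverse[OF g(1) H gH] inj g(2) by metis
  have "bij_betw g H H"
  proof (rule bij_betw_byWitness[of _ "poly_op g q"])
    show "poly_op g q ` H \<subseteq> H" using poly_op_invariant[OF g(1) sub gH] by blast
  qed (use q gH in blast)+
  then show ?thesis using bij_betw_cong[of H g f H] g(2) by simp
qed

context
  fixes H :: "'a::real_vector set" and M :: "'a \<Rightarrow> 'a" and L :: "'a \<Rightarrow> 'a \<Rightarrow> real"
  assumes fm: "form_module H M L"
begin

lemma form_module_subspace: "subspace H"
  using fm by (simp add: form_module_def fin_dim_space_def)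

lemma form_add_left: "x \<in> H \<Longrightarrow> y \<in> H \<Longrightarrow> z \<in> H \<Longrightarrow> L (x + y) z = L x z + L y z"
  and form_add_right: "x \<in> H \<Longrightarrow> y \<in> H \<Longrightarrow> z \<in> H \<Longrightarrow> L z (x + y) = L z x + L z y"
  and form_scale_left: "x \<in> H \<Longrightarrow> z \<in> H \<Longrightarrow> L (c *\<^sub>R x) z = c * L x z"
  and form_scale_right: "x \<in> H \<Longrightarrow> z \<in> H \<Longrightarrow> L z (c *\<^sub>R x) = c * L z x"
  using fm by (simp_all add: form_module_def bilinear_form_on_def linear_on_def)

lemma form_zero: "x \<in> H \<Longrightarrow> L 0 x = 0" "x \<in> H \<Longrightarrow> L x 0 = 0"
  using form_scale_left[of 0 x 0] form_scale_right[of 0 x 0] subspace_0[OF form_module_subspace] by auto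

lemma form_diff_left: "x \<in> H \<Longrightarrow> y \<in> H \<Longrightarrow> z \<in> H \<Longrightarrow> L (x - y) z = L x z - L y z"
  and form_diff_right: "x \<in> H \<Longrightarrow> y \<in> H \<Longrightarrow> z \<in> H \<Longrightarrow> L z (x - y) = L z x - L z y"
  using form_add_left[of "x - y" y z] form_add_right[of "x - y" y z] subspace_diff[OF form_module_subspace, of x y]
  by auto

lemma form_eq_0: "x \<in> H \<Longrightarrow> (\<And>y. y \<in> H \<Longrightarrow> L x y = 0) \<Longrightarrow> x = 0"
  using fm by (simp add: form_module_def nondegenerate_on_def)

end

text \<open>
  The identity \<open>L (a x) y = L x (a y)\<close> for all \<open>x, y\<close> says that \<open>a\<close> is both its left and its right
  adjoint, which is what two-sided orthogonality of the pieces of a splitting requires.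
\<close>

definition symmetric_op ::
    "'a::real_vector set \<Rightarrow> ('a \<Rightarrow> 'a) \<Rightarrow> ('a \<Rightarrow> 'a \<Rightarrow> real) \<Rightarrow> ('a \<Rightarrow> 'a) \<Rightarrow> bool" where
  "symmetric_op H M L a \<longleftrightarrow> linear a \<and> a ` H \<subseteq> H \<and> (\<forall>x\<in>H. a (M x) = M (a x)) \<and>
     (\<forall>x\<in>H. \<forall>y\<in>H. L (a x) y = L x (a y))"

lemma symmetric_opD:
  assumes "symmetric_op H M L a"
  shows "linear a" "a ` H \<subseteq> H" "x \<in> H \<Longrightarrow> a x \<in> H" "x \<in> H \<Longrightarrow> a (M x) = M (a x)"
    "x \<in> H \<Longrightarrow> y \<in> H \<Longrightarrow> L (a x) y = L x (a y)"
  using assms by (auto simp: symmetric_op_def)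

lemma symmetric_op_poly:
  assumes fm: "form_module H M L" and a: "symmetric_op H M L a"
  shows "symmetric_op H M L (poly_op a p)"
proof -
  note sub = form_module_subspace[OF fm] and aD = symmetric_opD[OF a]
  have inv: "poly_op a p x \<in> H" if "x \<in> H" for x p using poly_op_invariant[OF aD(1) sub aD(2) that] .
  have "linear_on H M" using fm by (simp add: form_module_def)
  then have com: "poly_op a p (M x) = M (poly_op a p x)" if "x \<in> H" for x
    using poly_op_commute[OF aD(1) sub aD(2)] aD(4) that by metis
  have "L (poly_op a p x) y = L x (poly_op a p y)" if "x \<in> H" "y \<in> H" for x y
    using that(1)
  proof (induction p arbitrary: x)
    case (pCons c p)
    have "L (a (poly_op a p x)) y = L x (a (poly_op a p y))"
      using pCons(2)[OF aD(3)] pCons(3) that(2) poly_op_commute[OF aD(1) sub aD(2) linear_on_linear[OF aD(1)]]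
        aD(5) inv by metis
    then show ?case using pCons(3) that(2) inv[of _ p] aD(3)
      by (simp add: aD(1,5) form_add_left[OF fm] form_add_right[OF fm] form_scale_left[OF fm] form_scale_right[OF fm] subspace_scale[OF sub])
  qed (use that form_zero[OF fm] in auto)
  then show ?thesis using inv com poly_op_linear[OF aD(1)] by (auto simp: symmetric_op_def)
qed

lemma symmetric_op_idempotent_split:
  assumes fm: "form_module H M L" and c: "symmetric_op H M L c" and idem: "\<And>x. x \<in> H \<Longrightarrow> c (c x) = c x"
  shows "orthogonal_split H M L (c ` H) {x \<in> H. c x = 0}"
proof -
  note sub = form_module_subspace[OF fm] and cD = symmetric_opD[OF c]
  have MH: "M x \<in> H" if "x \<in> H" for x using fm that by (auto simp: form_module_def)
  have M0: "M 0 = 0" using linear_on_0[OF sub] fm unfolding form_module_def by blast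
  have 1: "subspace (c ` H)" "subspace {x \<in> H. c x = 0}"
    using sub linear_subspace_image[OF cD(1) sub]
    by (auto simp: subspace_def linear_0[OF cD(1)] linear_add[OF cD(1)] linear_scale[OF cD(1)])
  have 2: "c ` H \<inter> {x \<in> H. c x = 0} = {0}"
    using idem subspace_0[OF sub] linear_0[OF cD(1)] by force
  have "\<exists>u v. x = u + v \<and> u \<in> c ` H \<and> v \<in> {x \<in> H. c x = 0}" if "x \<in> H" for x
    using that idem[OF that] cD(3) subspace_diff[OF sub that]
    by (intro exI[of _ "c x"] exI[of _ "x - c x"]) (simp add: linear_diff[OF cD(1)])
  then have 3: "H = {u + v |u v. u \<in> c ` H \<and> v \<in> {x \<in> H. c x = 0}}"
    using cD(3) subspace_add[OF sub] by auto
  have "L (c x) y = 0 \<and> L y (c x) = 0" if "x \<in> H" "y \<in> H" "c y = 0" for x y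
    using that cD(5)[of x y] cD(5)[of y x] form_zero[OF fm that(1)] by simp
  then have 4: "orthogonal_wrt L (c ` H) {x \<in> H. c x = 0}"
    by (auto simp: orthogonal_wrt_def)
  have 5: "M ` c ` H \<subseteq> c ` H" using cD(4) MH by (force simp flip: cD(4))
  have 6: "M ` {x \<in> H. c x = 0} \<subseteq> {x \<in> H. c x = 0}" using cD(4) MH M0 by auto
  show ?thesis unfolding orthogonal_split_def direct_sum2_def using 1 2 3 4 5 6 by blast
qed

text \<open>
  Write the annihilator \<open>m\<close> of \<open>a\<close> as \<open>f k\<close>, where \<open>f\<close> collects all factors \<open>X - c\<close>. With
  \<open>s f + t k = 1\<close>, the operator \<open>t(a) k(a)\<close> is a symmetric idempotent that fixes the eigenvectors for
  \<open>c\<close> and kills those for \<open>d\<close>, so it would split \<open>H\<close> nontrivially.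
\<close>

lemma irreducible_eigenvalue_unique:
  assumes irr: "irreducible_form_module H M L" and a: "symmetric_op H M L a"
    and x: "x \<in> H" "x \<noteq> 0" "a x = c *\<^sub>R x" and y: "y \<in> H" "y \<noteq> 0" "a y = d *\<^sub>R y"
  shows "c = d"
proof (rule ccontr)
  assume "c \<noteq> d"
  have fm: "form_module H M L" using irr by (simp add: irreducible_form_module_def)
  then have fd: "fin_dim_space H" by (simp add: form_module_def)
  note sub = form_module_subspace[OF fm] and aD = symmetric_opD[OF a]
  obtain m where m: "m \<noteq> 0" "\<And>x. x \<in> H \<Longrightarrow> poly_op a m x = 0"
    using minimal_poly[OF aD(1) fd aD(2)] by metis
  obtain k where k: "m = [:-c, 1:] ^ order c m * k" "\<not> [:-c, 1:] dvd k"
    using order_decomp[OF m(1)] by blast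
  define f where "f = [:-c, 1:] ^ order c m"
  have mf: "m = f * k" using k(1) by (simp add: f_def)
  have "prime_elem [:-c, 1:]"
    by (rule prime_elem_linear_poly) (auto intro: is_unit_right_imp_coprime)
  then have "coprime [:-c, 1:] k" by (rule prime_elem_imp_coprime[OF _ k(2)])
  then have "coprime f k" unfolding f_def by simp
  then obtain s t where st: "s * f + t * k = 1" using real_poly_bezout by blast
  have ann: "poly_op a (k * f * g) z = 0" if "z \<in> H" for z g
    by (rule poly_op_dvd[OF aD(1) _ m(2)[OF that]]) (simp add: mf)
  define e where "e = poly_op a (t * k)"
  have idem: "e (e z) = e z" if "z \<in> H" for z
  proof -
    have "t * k = t * k * (s * f + t * k)" using st by simp
    also have "\<dots> = k * f * (s * t) + t * k * (t * k)" by (simp add: algebra_simps)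
    finally show ?thesis using ann[OF that] unfolding e_def by (metis poly_op_add poly_op_mult[OF aD(1)] add_0)
  qed
  have sym: "symmetric_op H M L e" unfolding e_def by (rule symmetric_op_poly[OF fm a])
  from symmetric_op_idempotent_split[OF fm this idem] irr
  have triv: "e ` H = {0} \<or> {x \<in> H. e x = 0} = {0}" by (simp add: irreducible_form_module_def)
  have root: "poly m c = 0" "poly m d = 0"
    using m(2)[OF x(1)] m(2)[OF y(1)] x y by (simp_all add: poly_op_eigenvector[OF aD(1)])
  have kc: "poly k c \<noteq> 0" using k(2) by (simp add: poly_eq_0_iff_dvd)
  then have fc: "poly f c = 0" using root(1) mf by simp
  have "poly f d \<noteq> 0" using \<open>c \<noteq> d\<close> by (simp add: f_def poly_power)
  then have kd: "poly k d = 0" using root(2) mf by simp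
  have "poly (s * f + t * k) c = 1" using st by simp
  then have "poly (t * k) c = 1" using fc by simp
  then have "e x = x" unfolding e_def using poly_op_eigenvector[OF aD(1) x(3)] by simp
  moreover have "e y = 0" unfolding e_def using poly_op_eigenvector[OF aD(1) y(3)] kd by simp
  ultimately show False using triv x y by force
qed

text \<open>
  The projection to \<open>V\<close> along \<open>U\<close> is symmetric because the cross terms of \<open>L\<close> vanish on both sides.
\<close>

lemma orthogonal_split_projection:
  assumes fm: "form_module H M L" and sp: "orthogonal_split H M L V U"
  obtains e where "symmetric_op H M L e" "\<And>x. x \<in> V \<Longrightarrow> e x = x" "\<And>x. x \<in> U \<Longrightarrow> e x = 0"
    "\<And>x. x \<in> H \<Longrightarrow> e x \<in> V" "\<And>x. x \<in> H \<Longrightarrow> x - e x \<in> U"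
proof -
  have V: "subspace V" "M ` V \<subseteq> V" and U: "subspace U" "M ` U \<subseteq> U" and VU: "V \<inter> U = {0}"
    and HVU: "H = {x + y |x y. x \<in> V \<and> y \<in> U}" and orth: "orthogonal_wrt L V U"
    using sp by (auto simp: orthogonal_split_def direct_sum2_def)
  note sub = form_module_subspace[OF fm]
  have VH: "V \<subseteq> H" and UH: "U \<subseteq> H"
    using HVU subspace_0[OF U(1)] subspace_0[OF V(1)] by force+
  define e0 where "e0 x = (SOME v. v \<in> V \<and> x - v \<in> U)" for x
  have e0: "e0 x \<in> V \<and> x - e0 x \<in> U" if "x \<in> H" for x
  proof -
    obtain v u where "x = v + u" "v \<in> V" "u \<in> U" using \<open>x \<in> H\<close> HVU by blast
    then have "\<exists>v. v \<in> V \<and> x - v \<in> U" by (intro exI[of _ v]) simp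
    then show ?thesis unfolding e0_def by (rule someI_ex)
  qed
  have uniq: "e0 x = v" if "v \<in> V" "x - v \<in> U" for x v
  proof -
    have "x = v + (x - v)" by simp
    then have "x \<in> H" using that HVU by blast
    then have "v - e0 x \<in> V" "v - e0 x \<in> U"
      using e0 that subspace_diff[OF V(1)] subspace_diff[OF U(1), of "x - e0 x" "x - v"] by (auto simp: algebra_simps)
    then have "v - e0 x \<in> {0}" using VU by blast
    then show ?thesis by simp
  qed
  have "linear_on H e0" unfolding linear_on_def
  proof (intro conjI ballI allI)
    fix x y assume "x \<in> H" "y \<in> H"
    then show "e0 (x + y) = e0 x + e0 y"
      using e0[of x] e0[of y] subspace_add[OF V(1)] subspace_add[OF U(1), of "x - e0 x" "y - e0 y"]
      by (intro uniq) (auto simp: algebra_simps)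
  next
    fix c x assume "x \<in> H"
    then show "e0 (c *\<^sub>R x) = c *\<^sub>R e0 x"
      using e0[of x] subspace_scale[OF V(1)] subspace_scale[OF U(1), of "x - e0 x" c]
      by (intro uniq) (auto simp: algebra_simps)
  qed
  then obtain e where e: "linear e" "\<And>x. x \<in> H \<Longrightarrow> e x = e0 x" using linear_on_extend[OF sub] by blast
  have eV: "e x = x" if "x \<in> V" for x
    using that VH e(2)[of x] uniq[of x x] subspace_0[OF U(1)] by auto
  have eU: "e x = 0" if "x \<in> U" for x
    using that UH e(2)[of x] uniq[of 0 x] subspace_0[OF V(1)] by auto
  have e1: "e x \<in> V" "x - e x \<in> U" if "x \<in> H" for x
    using e0[OF that] e(2)[OF that] by auto
  have M: "linear_on H M" using fm by (simp add: form_module_def)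
  have "e (M x) = M (e x)" if "x \<in> H" for x
  proof -
    have "M x = M (e x + (x - e x))" by simp
    also have "\<dots> = M (e x) + M (x - e x)"
      using M e1[OF that] VH UH unfolding linear_on_def by blast
    finally have *: "M x = M (e x) + M (x - e x)" .
    have "e (M (e x)) = M (e x)" "e (M (x - e x)) = 0" using e1[OF that] V(2) U(2) eV eU by auto
    then show ?thesis using * linear_add[OF e(1)] by simp
  qed
  moreover have "L (e x) y = L x (e y)" if "x \<in> H" "y \<in> H" for x y
  proof -
    note h = e1[OF that(1)] e1[OF that(2)]
    have hH: "e x \<in> H" "x - e x \<in> H" "e y \<in> H" "y - e y \<in> H" using h VH UH by auto
    have "L (e x) (y - e y) = 0" "L (x - e x) (e y) = 0" using orth h by (auto simp: orthogonal_wrt_def)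
    then show ?thesis using hH that by (simp add: form_diff_left[OF fm] form_diff_right[OF fm])
  qed
  ultimately have "symmetric_op H M L e" using e(1) e1 VH by (auto simp: symmetric_op_def)
  then show thesis using that eV eU e1 by blast
qed


section \<open>Conjugating symmetric idempotents\<close>

definition form_isometry ::
    "('a::real_vector \<Rightarrow> 'a) \<Rightarrow> ('a \<Rightarrow> 'a \<Rightarrow> real) \<Rightarrow> 'a set \<Rightarrow> 'a set \<Rightarrow> ('a \<Rightarrow> 'a) \<Rightarrow> bool" where
  "form_isometry M L H K f \<longleftrightarrow> linear_on H f \<and> bij_betw f H K \<and>
     (\<forall>x\<in>H. f (M x) = M (f x)) \<and> (\<forall>x\<in>H. \<forall>y\<in>H. L (f x) (f y) = L x y)"

text \<open>
  The operator \<open>T\<close> is \<open>1 - (e - d)\<^sup>2\<close>, written out. It commutes with both idempotents, and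
  \<open>w = 1 - e - d + 2 d e = d e + (1 - d) (1 - e)\<close> intertwines them. The adjoint \<open>w'\<close> of \<open>w\<close> satisfies
  \<open>w' w = T\<close>, so \<open>u = w T\<^bsup>-1/2\<^esup>\<close> preserves the form.
\<close>

lemma idempotents_conjugate:
  assumes fm: "form_module H M L"
    and e: "symmetric_op H M L e" and ee: "\<And>x. x \<in> H \<Longrightarrow> e (e x) = e x"
    and d: "symmetric_op H M L d" and dd: "\<And>x. x \<in> H \<Longrightarrow> d (d x) = d x"
    and T: "\<And>x. T x = x - (e (e x) - e (d x) - d (e x) + d (d x))"
    and pos: "\<And>x c. x \<in> H \<Longrightarrow> T x = c *\<^sub>R x \<Longrightarrow> c \<le> 0 \<Longrightarrow> x = 0"
  shows "\<exists>u. form_isometry M L H H u \<and> (\<forall>x\<in>H. u (e x) = d (u x))"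
proof -
  note sub = form_module_subspace[OF fm] and eD = symmetric_opD[OF e] and dD = symmetric_opD[OF d]
  have fd: "fin_dim_space H" and Mlin: "linear_on H M" and MH: "\<And>x. x \<in> H \<Longrightarrow> M x \<in> H"
    using fm by (auto simp: form_module_def)
  have Msub: "M (x - y) = M x - M y" if "x \<in> H" "y \<in> H" for x y
    using linear_on_diff[OF sub Mlin] that by blast
  have Madd: "M (x + y) = M x + M y" if "x \<in> H" "y \<in> H" for x y
    using Mlin that by (simp add: linear_on_def)
  note subc = subspace_diff[OF sub] subspace_add[OF sub] eD(3) dD(3)
  note lin = linear_add[OF eD(1)] linear_diff[OF eD(1)] linear_add[OF dD(1)] linear_diff[OF dD(1)]
    linear_scale[OF eD(1)] linear_scale[OF dD(1)]
  note bil = form_diff_left[OF fm] form_diff_right[OF fm] form_add_left[OF fm] form_add_right[OF fm]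
  have linT: "linear T" unfolding linear_iff T by (simp add: lin algebra_simps)
  have TH: "T x \<in> H" if "x \<in> H" for x unfolding T using that by (intro subc)
  then have TsH: "T ` H \<subseteq> H" by blast
  have TM: "T (M x) = M (T x)" if "x \<in> H" for x
    unfolding T using that by (simp add: eD(4) dD(4) Msub Madd subc)
  have TL: "L (T x) y = L x (T y)" if "x \<in> H" "y \<in> H" for x y
    unfolding T using that by (simp add: bil eD(5) dD(5) subc)
  have symT: "symmetric_op H M L T"
    unfolding symmetric_op_def using linT TH TM TL by blast
  have Te: "T (e x) = e (T x)" if "x \<in> H" for x
    unfolding T using that by (simp add: lin ee dd subc)
  obtain p where p: "\<And>x. x \<in> H \<Longrightarrow> poly_op T p (poly_op T p x) = T x"
    using poly_op_sqrt[OF linT fd TsH] pos by blast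
  have "x = 0" if "x \<in> H" "T x = 0" for x using pos[of x 0] that by simp
  then obtain q where q: "\<And>x. x \<in> H \<Longrightarrow> T (poly_op T q x) = x" "\<And>x. x \<in> H \<Longrightarrow> poly_op T q (T x) = x"
    using poly_op_inverse[OF linT fd TsH] by metis
  define r where "r = poly_op T (p * q)"
  have r: "symmetric_op H M L r" unfolding r_def by (rule symmetric_op_poly[OF fm symT])
  note rD = symmetric_opD[OF r]
  \<comment> \<open>The operator \<open>r\<close> is \<open>T\<^bsup>-1/2\<^esup>\<close>, as the product of a square root and the inverse of \<open>T\<close>.\<close>
  have rTr: "r (T (r x)) = x" if "x \<in> H" for x
  proof -
    have qx: "poly_op T q x \<in> H" "poly_op T q (poly_op T q x) \<in> H"
      using poly_op_invariant[OF linT sub TsH] that by blast+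
    have X: "poly_op T [:0, 1:] y = T y" for y by (simp add: poly_op_pCons[OF linT] linear_0[OF linT])
    have "r (T (r x)) = poly_op T ((p * q) * [:0, 1:] * (p * q)) x"
      unfolding r_def poly_op_mult[OF linT] X ..
    also have "(p * q) * [:0, 1:] * (p * q) = p * p * ([:0, 1:] * (q * q))" by (simp only: ac_simps)
    also have "poly_op T \<dots> x = T (T (poly_op T q (poly_op T q x)))"
      using p[of "T (poly_op T q (poly_op T q x))"] TH[OF qx(2)] unfolding poly_op_mult[OF linT] X by blast
    finally show ?thesis using q(1) qx that by simp
  qed
  have re: "r (e x) = e (r x)" if "x \<in> H" for x
    unfolding r_def by (rule poly_op_commute[OF linT sub TsH linear_on_linear[OF eD(1)] Te that])
  define w where "w x = x - e x - d x + (d (e x) + d (e x))" for x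
  define w' where "w' x = x - e x - d x + (e (d x) + e (d x))" for x
  have wH: "w x \<in> H" if "x \<in> H" for x unfolding w_def using that by (intro subc)
  have linw: "linear w" unfolding linear_iff w_def by (simp add: lin algebra_simps)
  have wM: "w (M x) = M (w x)" if "x \<in> H" for x
    unfolding w_def using that by (simp add: eD(4) dD(4) Msub Madd subc)
  have wL: "L (w x) y = L x (w' y)" if "x \<in> H" "y \<in> H" for x y
    unfolding w_def w'_def using that by (simp add: bil eD(5) dD(5) subc)
  have w'w: "w' (w x) = T x" if "x \<in> H" for x
    unfolding w_def w'_def T using that by (simp add: lin ee dd subc)
  have we: "w (e x) = d (w x)" if "x \<in> H" for x
    unfolding w_def using that by (simp add: lin ee dd subc)
  define u where "u x = w (r x)" for x
  have uL: "L (u x) (u y) = L x y" if "x \<in> H" "y \<in> H" for x y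
  proof -
    have "L (u x) (u y) = L (r x) (T (r y))"
      unfolding u_def using that by (simp add: wL wH rD(3) w'w)
    also have "\<dots> = L x y" using that by (simp add: rD(5) rD(3) TH rTr)
    finally show ?thesis .
  qed
  have uH: "u x \<in> H" if "x \<in> H" for x unfolding u_def using that rD(3) wH by blast
  have linu: "linear_on H u"
    unfolding u_def linear_on_def by (simp add: linear_add[OF linw] linear_add[OF rD(1)] linear_scale[OF linw] linear_scale[OF rD(1)])
  have "x = 0" if "x \<in> H" "u x = 0" for x
  proof (rule form_eq_0[OF fm that(1)])
    fix y assume "y \<in> H"
    then show "L x y = 0" using uL[OF that(1)] that(2) form_zero(1)[OF fm uH] by metis
  qed
  then have "bij_betw u H H" using injective_endomorphism_bij[OF fd linu] uH by blast
  moreover have "u (M x) = M (u x)" if "x \<in> H" for x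
    unfolding u_def using that rD(3,4) wM by simp
  ultimately have "form_isometry M L H H u" using linu uL by (simp add: form_isometry_def)
  moreover have "u (e x) = d (u x)" if "x \<in> H" for x
    unfolding u_def using that rD(3) re we by simp
  ultimately show ?thesis by blast
qed

lemma orthogonal_split_commute:
  assumes "orthogonal_split H M L V U"
  shows "orthogonal_split H M L U V"
proof -
  have "{x + y |x y. x \<in> V \<and> y \<in> U} = {x + y |x y. x \<in> U \<and> y \<in> V}"
    by (metis (no_types, lifting) add.commute)
  then show ?thesis
    using assms unfolding orthogonal_split_def direct_sum2_def orthogonal_wrt_def by (simp add: Int_commute)
qed

text \<open>
  Nondegeneracy passes to \<open>V\<close>: pairing an element of \<open>V\<close> with \<open>y\<close> or with the projection of \<open>y\<close> to \<open>V\<close>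
  gives the same value.
\<close>

lemma orthogonal_split_parts:
  assumes fm: "form_module H M L" and sp: "orthogonal_split H M L V U"
  shows "V \<subseteq> H" "U \<subseteq> H" "form_module V M L" "form_module U M L"
proof -
  have *: "V \<subseteq> H \<and> form_module V M L" if sp: "orthogonal_split H M L V U" for V U
  proof -
    have V: "subspace V" "M ` V \<subseteq> V" and U: "subspace U"
      and HVU: "H = {x + y |x y. x \<in> V \<and> y \<in> U}" and orth: "orthogonal_wrt L V U"
      using sp by (auto simp: orthogonal_split_def direct_sum2_def)
    have VH: "V \<subseteq> H" and UH: "U \<subseteq> H" using HVU subspace_0[OF V(1)] subspace_0[OF U] by force+
    obtain e where e: "symmetric_op H M L e" "\<And>x. x \<in> V \<Longrightarrow> e x = x" "\<And>x. x \<in> H \<Longrightarrow> e x \<in> V"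
      using orthogonal_split_projection[OF fm sp] by metis
    obtain B where B: "finite B" "span B = H" using fm by (auto simp: form_module_def fin_dim_space_def)
    have "e ` H = V" using e(2,3) VH by force
    then have "span (e ` B) = V" using linear_span_image[OF symmetric_opD(1)[OF e(1)]] B(2) by metis
    then have "fin_dim_space V" unfolding fin_dim_space_def using V(1) B(1) by blast
    moreover have "linear_on V M" using fm linear_on_subset VH by (auto simp: form_module_def)
    moreover have "bilinear_form_on V L"
      using fm VH linear_on_subset[OF _ VH] unfolding form_module_def bilinear_form_on_def by blast
    moreover have "nondegenerate_on V L"
    proof -
      have "x = 0" if x: "x \<in> V" "(\<forall>y\<in>V. L x y = 0) \<or> (\<forall>y\<in>V. L y x = 0)" for x
      proof -
        have "L x y = L x (e y) \<and> L y x = L (e y) x" if "y \<in> H" for y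
          using symmetric_opD(5)[OF e(1)] that x(1) VH e(2)[OF x(1)] by (metis subsetD)
        then have "(\<forall>y\<in>H. L x y = 0) \<or> (\<forall>y\<in>H. L y x = 0)" using x(2) e(3) by auto
        then show ?thesis using fm x(1) VH by (auto simp: form_module_def nondegenerate_on_def)
      qed
      then show ?thesis by (auto simp: nondegenerate_on_def)
    qed
    ultimately show ?thesis using VH V by (simp add: form_module_def)
  qed
  from *[OF sp] *[OF orthogonal_split_commute[OF sp]] show "V \<subseteq> H" "U \<subseteq> H" "form_module V M L" "form_module U M L" by blast+
qed

text \<open>
  The compression of a symmetric operator \<open>p\<close> to the image \<open>V\<close> of a symmetric idempotent \<open>e\<close>.
\<close>

lemma symmetric_op_compression:
  assumes e: "symmetric_op H M L e" "\<And>x. x \<in> V \<Longrightarrow> e x = x" "\<And>x. x \<in> H \<Longrightarrow> e x \<in> V"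
    and V: "V \<subseteq> H" and p: "symmetric_op H M L p"
  shows "symmetric_op V M L (\<lambda>x. e (p x))"
proof -
  note eD = symmetric_opD[OF e(1)] and pD = symmetric_opD[OF p]
  have "linear (\<lambda>x. e (p x))"
    by (simp add: linear_iff linear_add[OF eD(1)] linear_add[OF pD(1)] linear_scale[OF eD(1)] linear_scale[OF pD(1)])
  moreover have "L (e (p x)) y = L x (e (p y))" if "x \<in> V" "y \<in> V" for x y
    using that V e(2) by (metis eD(5) pD(3,5) subsetD)
  moreover have "e (p x) \<in> V" "e (p (M x)) = M (e (p x))" if "x \<in> V" for x
    using that V e(3) by (auto simp: eD(4) pD(3,4))
  ultimately show ?thesis by (auto simp: symmetric_op_def)
qed

text \<open>
  Let \<open>t\<close> be the inverse of the compression \<open>a = e p\<close> of \<open>p\<close> to \<open>V\<close>. Then \<open>d = p t e p\<close> is a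
  symmetric idempotent with image inside that of \<open>p\<close>, and \<open>e d = e p\<close>. To conjugate \<open>e\<close> into \<open>d\<close> one needs
  that \<open>T = 1 - (e - d)\<^sup>2\<close> has no eigenvalue \<open>c \<le> 0\<close>. On \<open>V\<close> it equals \<open>a\<close>. As \<open>T\<close> commutes with
  \<open>e\<close> and \<open>d\<close>, an eigenvector \<open>x\<close> for \<open>c\<close> therefore has \<open>e x = 0\<close> and \<open>e d x = 0\<close>; the latter gives
  \<open>d x = 0\<close>, so \<open>T x = x\<close>, which is impossible.
\<close>

lemma move_into_summand:
  assumes fm: "form_module H M L"
    and e: "symmetric_op H M L e" "\<And>x. x \<in> V \<Longrightarrow> e x = x" "\<And>x. x \<in> H \<Longrightarrow> e x \<in> V"
    and V: "form_module V M L" "V \<subseteq> H"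
    and p: "symmetric_op H M L p" "\<And>x. x \<in> H \<Longrightarrow> p (p x) = p x"
    and pos: "\<And>x c. x \<in> V \<Longrightarrow> e (p x) = c *\<^sub>R x \<Longrightarrow> c \<le> 0 \<Longrightarrow> x = 0"
  shows "\<exists>u. form_isometry M L H H u \<and> u ` V \<subseteq> p ` H"
proof -
  note eD = symmetric_opD[OF e(1)] and pD = symmetric_opD[OF p(1)]
  define a where "a x = e (p x)" for x
  have lina: "linear a" unfolding a_def by (simp add: linear_iff linear_add[OF eD(1)] linear_add[OF pD(1)] linear_scale[OF eD(1)] linear_scale[OF pD(1)])
  have aV: "a x \<in> V" if "x \<in> H" for x unfolding a_def using that e(3) pD(3) by blast
  have a: "symmetric_op V M L a" unfolding a_def by (rule symmetric_op_compression[OF e V(2) p(1)])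
  note aD = symmetric_opD[OF a]
  have fdV: "fin_dim_space V" using V(1) by (simp add: form_module_def)
  have "x = 0" if "x \<in> V" "a x = 0" for x using pos[of x 0] that by (simp add: a_def)
  then obtain q where q: "\<And>x. x \<in> V \<Longrightarrow> a (poly_op a q x) = x" "\<And>x. x \<in> V \<Longrightarrow> poly_op a q (a x) = x"
    using poly_op_inverse[OF lina fdV aD(2)] by metis
  define t where "t = poly_op a q"
  have t: "symmetric_op V M L t" unfolding t_def by (rule symmetric_op_poly[OF V(1) a])
  note tD = symmetric_opD[OF t] and q = q[folded t_def]
  define d where "d x = p (t (e (p x)))" for x
  have ep: "e (p x) \<in> V" if "x \<in> H" for x using that e(3) pD(3) by blast
  have tH: "t x \<in> H" if "x \<in> V" for x using tD(3) that V(2) by blast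
  have dH: "d x \<in> p ` H" if "x \<in> H" for x unfolding d_def using ep[OF that] tH by blast
  have epd: "d (d x) = d x" "e (d x) = e (p x)" if "x \<in> H" for x
    using q(1)[OF ep[OF that]] p(2)[OF tH[OF ep[OF that]]] by (simp_all add: d_def a_def)
  have d: "symmetric_op H M L d"
    unfolding symmetric_op_def
  proof (intro conjI ballI)
    show "linear d" unfolding d_def by (simp add: linear_iff linear_add[OF eD(1)] linear_add[OF pD(1)] linear_scale[OF eD(1)] linear_scale[OF pD(1)] linear_add[OF tD(1)] linear_scale[OF tD(1)])
    show "d ` H \<subseteq> H" using dH pD(2) by blast
    fix x assume x: "x \<in> H"
    show "d (M x) = M (d x)" unfolding d_def using x ep[OF x] tH by (simp add: pD(3,4) eD(4) tD(4))
    fix y assume y: "y \<in> H"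
    have "L (d x) y = L (t (e (p x))) (p y)" unfolding d_def using pD(5)[OF tH[OF ep[OF x]] y] .
    also have "\<dots> = L (e (t (e (p x)))) (p y)" using e(2) tD(3) ep[OF x] by simp
    also have "\<dots> = L (t (e (p x))) (e (p y))" using eD(5)[OF tH[OF ep[OF x]] pD(3)[OF y]] .
    also have "\<dots> = L (e (p x)) (t (e (p y)))" using tD(5)[OF ep[OF x] ep[OF y]] .
    also have "\<dots> = L (p x) (e (t (e (p y))))" using eD(5)[OF pD(3)[OF x] tH[OF ep[OF y]]] .
    also have "\<dots> = L (p x) (t (e (p y)))" using e(2) tD(3) ep[OF y] by simp
    also have "\<dots> = L x (d y)" unfolding d_def using pD(5)[OF x tH[OF ep[OF y]]] .
    finally show "L (d x) y = L x (d y)" .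
  qed
  note dD = symmetric_opD[OF d]
  have ee: "e (e x) = e x" if "x \<in> H" for x using e(2,3) that by blast
  define T where "T x = x - (e (e x) - e (d x) - d (e x) + d (d x))" for x
  have TV: "T x = e (p x)" if "x \<in> V" for x
  proof -
    have "x \<in> H" using that V(2) by blast
    then show ?thesis unfolding T_def using e(2)[OF that] epd[of x] by simp
  qed
  have Te: "T (e x) = e (T x)" and Td: "T (d x) = d (T x)" if "x \<in> H" for x
    unfolding T_def using that ee ee[OF pD(3)] epd eD(3) dD(3) by (simp_all add: linear_diff[OF eD(1)] linear_diff[OF dD(1)] linear_add[OF eD(1)] linear_add[OF dD(1)])
  have "x = 0" if x: "x \<in> H" "T x = c *\<^sub>R x" "c \<le> 0" for x c
  proof -
    have *: "e y = 0" if "y \<in> H" "T y = c *\<^sub>R y" for y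
    proof (rule pos[of _ c])
      show "e y \<in> V" using e(3) that(1) .
      show "e (p (e y)) = c *\<^sub>R e y"
        using TV[OF e(3)[OF that(1)]] Te[OF that(1)] that(2) by (simp add: linear_scale[OF eD(1)])
    qed (rule x)
    have ex: "e x = 0" using * x by blast
    have "e (d x) = 0" using *[OF dD(3)[OF x(1)]] Td[OF x(1)] x(2) by (simp add: linear_scale[OF dD(1)])
    then have "e (p x) = 0" using epd(2)[OF x(1)] by simp
    then have "d x = 0" by (simp add: d_def linear_0[OF tD(1)] linear_0[OF pD(1)])
    then have "T x = x" using ex by (simp add: T_def linear_0[OF eD(1)] linear_0[OF dD(1)])
    then have "(1 - c) *\<^sub>R x = 0" using x(2) by (simp add: scaleR_diff_left)
    then show ?thesis using x(3) by simp
  qed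
  then have "\<exists>u. form_isometry M L H H u \<and> (\<forall>x\<in>H. u (e x) = d (u x))"
    using idempotents_conjugate[OF fm e(1) _ d _ T_def] ee epd(1) by blast
  then obtain u where u: "form_isometry M L H H u" "\<And>x. x \<in> H \<Longrightarrow> u (e x) = d (u x)" by blast
  have "u x \<in> p ` H" if "x \<in> V" for x
  proof -
    have x: "x \<in> H" using that V(2) by blast
    then have "u x \<in> H" using u(1) by (auto simp: form_isometry_def bij_betw_def)
    then show ?thesis using u(2)[OF x] e(2)[OF that] dH by metis
  qed
  then show ?thesis using u(1) by blast
qed

text \<open>
  With \<open>p\<close> and \<open>p' = 1 - p\<close> the projections to \<open>W\<close> and \<open>Z\<close>, one of the compressions of \<open>p\<close> and \<open>p'\<close>
  to \<open>V\<close> has no eigenvalue in \<open>(-\<infinity>, 0]\<close>: an eigenvalue \<open>d \<le> 0\<close> of the second is an eigenvalue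
  \<open>1 - d \<ge> 1\<close> of the first, which cannot also have one that is \<open>\<le> 0\<close>.
\<close>

lemma move_irreducible_into_summand:
  assumes fm: "form_module H M L"
    and V: "orthogonal_split H M L V U" "irreducible_form_module V M L"
    and W: "orthogonal_split H M L W Z"
  obtains u where "form_isometry M L H H u" "u ` V \<subseteq> W \<or> u ` V \<subseteq> Z"
proof -
  note sub = form_module_subspace[OF fm]
  obtain e where e: "symmetric_op H M L e" "\<And>x. x \<in> V \<Longrightarrow> e x = x" "\<And>x. x \<in> H \<Longrightarrow> e x \<in> V"
    using orthogonal_split_projection[OF fm V(1)] by metis
  obtain p where p: "symmetric_op H M L p" "\<And>x. x \<in> W \<Longrightarrow> p x = x" "\<And>x. x \<in> H \<Longrightarrow> p x \<in> W"
    "\<And>x. x \<in> H \<Longrightarrow> x - p x \<in> Z"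
    using orthogonal_split_projection[OF fm W] by metis
  note eD = symmetric_opD[OF e(1)] and pD = symmetric_opD[OF p(1)]
  have Vm: "form_module V M L" "V \<subseteq> H" using orthogonal_split_parts[OF fm V(1)] by blast+
  have pp: "p (p x) = p x" if "x \<in> H" for x using p(2,3) that by blast
  define p' where "p' x = x - p x" for x
  \<comment> \<open>Being a polynomial in \<open>p\<close>, the complementary projection is symmetric as well.\<close>
  have poly: "p' = poly_op p [:1, -1:]"
    by (rule ext) (simp add: p'_def poly_op_pCons[OF pD(1)] linear_neg[OF pD(1)] linear_0[OF pD(1)])
  have p': "symmetric_op H M L p'" unfolding poly by (rule symmetric_op_poly[OF fm p(1)])
  have pp': "p' (p' x) = p' x" if "x \<in> H" for x
    unfolding p'_def using pp[OF that] by (simp add: linear_diff[OF pD(1)])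
  show thesis
  proof (cases "\<forall>x c. x \<in> V \<longrightarrow> e (p x) = c *\<^sub>R x \<longrightarrow> c \<le> 0 \<longrightarrow> x = 0")
    case True
    have "\<exists>u. form_isometry M L H H u \<and> u ` V \<subseteq> p ` H"
      by (rule move_into_summand[OF fm e(1) _ _ Vm p(1)]) (use e(2,3) pp True in blast)+
    then obtain u where "form_isometry M L H H u" "u ` V \<subseteq> p ` H" by blast
    moreover have "p ` H \<subseteq> W" using p(3) by blast
    ultimately show thesis using that by (meson order_trans)
  next
    case False
    then obtain x c where x: "x \<in> V" "e (p x) = c *\<^sub>R x" "c \<le> 0" "x \<noteq> 0" by blast
    define a where "a x = e (p x)" for x
    have "symmetric_op V M L a" unfolding a_def by (rule symmetric_op_compression[OF e Vm(2) p(1)])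
    note uniq = irreducible_eigenvalue_unique[OF V(2) this]
    have "y = 0" if y: "y \<in> V" "e (p' y) = d *\<^sub>R y" "d \<le> 0" for y d
    proof (rule ccontr)
      assume "y \<noteq> 0"
      have "a y = (1 - d) *\<^sub>R y"
        using y(2) e(2)[OF y(1)] by (simp add: a_def p'_def linear_diff[OF eD(1)] algebra_simps)
      then have "c = 1 - d" using uniq[OF x(1,4) _ y(1) \<open>y \<noteq> 0\<close>] x(2) by (simp add: a_def)
      then show False using x(3) y(3) by simp
    qed
    then have "\<exists>u. form_isometry M L H H u \<and> u ` V \<subseteq> p' ` H"
      by (intro move_into_summand[OF fm e(1) _ _ Vm p']) (use e(2,3) pp' in blast)+
    then obtain u where "form_isometry M L H H u" "u ` V \<subseteq> p' ` H" by blast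
    moreover have "p' ` H \<subseteq> Z" using p(4) by (auto simp: p'_def)
    ultimately show thesis using that by (meson order_trans)
  qed
qed


section \<open>Moving irreducible summands by isometries\<close>

lemma form_isometryD:
  assumes "form_isometry M L H K f"
  shows "linear_on H f" "bij_betw f H K" "f ` H = K" "x \<in> H \<Longrightarrow> f x \<in> K"
    "x \<in> H \<Longrightarrow> f (M x) = M (f x)" "x \<in> H \<Longrightarrow> y \<in> H \<Longrightarrow> L (f x) (f y) = L x y"
  using assms by (auto simp: form_isometry_def bij_betw_def)

lemma form_isometry_comp:
  assumes "form_isometry M L H K f" "form_isometry M L K N g"
  shows "form_isometry M L H N (\<lambda>x. g (f x))"
proof -
  note f = form_isometryD[OF assms(1)] and g = form_isometryD[OF assms(2)]
  have "bij_betw (\<lambda>x. g (f x)) H N" using bij_betw_trans[OF f(2) g(2)] by (simp add: comp_def)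
  then show ?thesis using f g unfolding form_isometry_def linear_on_def by simp
qed

lemma form_isometry_restrict:
  assumes "form_isometry M L H K f" "V \<subseteq> H"
  shows "form_isometry M L V (f ` V) f"
  using assms linear_on_subset[of H f V] bij_betw_subset[of f H K V]
  unfolding form_isometry_def by blast

lemma form_isometry_inverse:
  assumes H: "subspace H" "M ` H \<subseteq> H" and f: "form_isometry M L H K f"
  obtains g where "form_isometry M L K H g" "\<And>x. x \<in> H \<Longrightarrow> g (f x) = x"
proof -
  note fD = form_isometryD[OF f]
  define g where "g = the_inv_into H f"
  have inj: "inj_on f H" using fD(2) by (rule bij_betw_imp_inj_on)
  have gf: "g (f x) = x" if "x \<in> H" for x unfolding g_def using the_inv_into_f_f[OF inj that] .
  have fg: "\<exists>x\<in>H. y = f x \<and> g y = x" if "y \<in> K" for y using that fD(3) gf by force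
  have "linear_on K g" unfolding linear_on_def
  proof (intro conjI ballI allI)
    fix y z assume "y \<in> K" "z \<in> K"
    then obtain a b where "a \<in> H" "b \<in> H" "y = f a" "z = f b" using fg by metis
    then show "g (y + z) = g y + g z"
      using fD(1) gf[of "a + b"] gf subspace_add[OF H(1)] by (simp add: linear_on_def)
  next
    fix c y assume "y \<in> K"
    then obtain a where "a \<in> H" "y = f a" using fg by metis
    then show "g (c *\<^sub>R y) = c *\<^sub>R g y"
      using fD(1) gf[of "c *\<^sub>R a"] gf subspace_scale[OF H(1)] by (simp add: linear_on_def)
  qed
  moreover have "bij_betw g K H" unfolding g_def by (rule bij_betw_the_inv_into[OF fD(2)])
  moreover have "g (M y) = M (g y)" if "y \<in> K" for y
    using fg[OF that] fD(5) gf H(2) by (metis image_subset_iff)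
  moreover have "L (g y) (g z) = L y z" if "y \<in> K" "z \<in> K" for y z
    using fg[OF that(1)] fg[OF that(2)] fD(6) by metis
  ultimately have "form_isometry M L K H g" by (simp add: form_isometry_def)
  then show thesis using that gf by blast
qed

lemma orthogonal_split_image:
  assumes fm: "form_module H M L" and f: "form_isometry M L H K f" and sp: "orthogonal_split H M L V U"
  shows "orthogonal_split K M L (f ` V) (f ` U)"
proof -
  note fD = form_isometryD[OF f] and sub = form_module_subspace[OF fm]
  have VH: "V \<subseteq> H" and UH: "U \<subseteq> H" using orthogonal_split_parts[OF fm sp] by blast+
  have sV: "subspace V" and sU: "subspace U" and VU: "V \<inter> U = {0}"
    and HVU: "H = {x + y |x y. x \<in> V \<and> y \<in> U}" and orth: "orthogonal_wrt L V U"
    and MV: "M ` V \<subseteq> V" and MU: "M ` U \<subseteq> U"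
    using sp by (simp_all add: orthogonal_split_def direct_sum2_def)
  obtain g where g: "linear g" "\<And>x. x \<in> H \<Longrightarrow> g x = f x" using linear_on_extend[OF sub fD(1)] by blast
  have im: "f ` X = g ` X" if "X \<subseteq> H" for X using g(2) that by (intro image_cong) auto
  have "subspace (f ` V)" "subspace (f ` U)"
    using linear_subspace_image[OF g(1)] sV sU im VH UH by simp_all
  moreover have "f ` V \<inter> f ` U = f ` (V \<inter> U)"
    using inj_on_image_Int[OF bij_betw_imp_inj_on[OF fD(2)] VH UH] by simp
  then have "f ` V \<inter> f ` U = {0}" using VU linear_on_0[OF sub fD(1)] by simp
  moreover have "K = {x + y |x y. x \<in> f ` V \<and> y \<in> f ` U}"
  proof -
    have fadd: "f (x + y) = f x + f y" if "x \<in> V" "y \<in> U" for x y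
      using fD(1) that VH UH by (auto simp: linear_on_def)
    show ?thesis
    proof (intro set_eqI iffI)
      fix z assume "z \<in> K"
      then obtain x y where "z = f (x + y)" "x \<in> V" "y \<in> U" using fD(3) HVU by blast
      then show "z \<in> {x + y |x y. x \<in> f ` V \<and> y \<in> f ` U}" using fadd by blast
    next
      fix z assume "z \<in> {x + y |x y. x \<in> f ` V \<and> y \<in> f ` U}"
      then obtain x y where xy: "z = f x + f y" "x \<in> V" "y \<in> U" by blast
      then have "x + y \<in> H" using HVU by blast
      then show "z \<in> K" using fadd[OF xy(2,3)] xy(1) fD(4) by metis
    qed
  qed
  moreover have "orthogonal_wrt L (f ` V) (f ` U)"
    using orth fD(6) VH UH unfolding orthogonal_wrt_def by (simp add: subset_iff)
  moreover have Mf: "M ` f ` X \<subseteq> f ` X" if "M ` X \<subseteq> X" "X \<subseteq> H" for X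
  proof -
    have "M (f x) \<in> f ` X" if "x \<in> X" for x
    proof -
      have "M (f x) = f (M x)" "M x \<in> X" using that \<open>X \<subseteq> H\<close> \<open>M ` X \<subseteq> X\<close> fD(5)[of x] by auto
      then show ?thesis by simp
    qed
    then show ?thesis by blast
  qed
  have "M ` f ` V \<subseteq> f ` V" "M ` f ` U \<subseteq> f ` U"
    using Mf[OF MV VH] Mf[OF MU UH] .
  ultimately show ?thesis by (simp add: orthogonal_split_def direct_sum2_def)
qed

lemma irreducible_image:
  assumes irr: "irreducible_form_module V M L" and f: "form_isometry M L V W f" and W: "form_module W M L"
  shows "irreducible_form_module W M L"
proof -
  have V: "form_module V M L" "V \<noteq> {0}" using irr by (auto simp: irreducible_form_module_def)
  note fD = form_isometryD[OF f] and sub = form_module_subspace[OF V(1)]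
  obtain g where g: "form_isometry M L W V g" "\<And>x. x \<in> V \<Longrightarrow> g (f x) = x"
    using form_isometry_inverse[OF sub _ f] V(1) unfolding form_module_def by blast
  have g0: "X = {0}" if "g ` X = {0}" "X \<subseteq> W" "0 \<in> X" for X
  proof -
    have "x = 0" if "x \<in> X" for x
    proof (rule inj_onD[OF bij_betw_imp_inj_on[OF form_isometryD(2)[OF g(1)]]])
      show "g x = g 0" using \<open>g ` X = {0}\<close> \<open>0 \<in> X\<close> that by (metis image_eqI singletonD)
    qed (use that \<open>X \<subseteq> W\<close> \<open>0 \<in> X\<close> in auto)
    then show ?thesis using \<open>0 \<in> X\<close> by blast
  qed
  have "A = {0} \<or> B = {0}" if sp: "orthogonal_split W M L A B" for A B
  proof -
    have "g ` A = {0} \<or> g ` B = {0}"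
      using orthogonal_split_image[OF W g(1) sp] irr by (simp add: irreducible_form_module_def)
    moreover have "A \<subseteq> W" "B \<subseteq> W" using orthogonal_split_parts[OF W sp] by blast+
    moreover have "0 \<in> A" "0 \<in> B" using sp by (auto simp: orthogonal_split_def direct_sum2_def)
    ultimately show ?thesis using g0 by blast
  qed
  moreover have "W \<noteq> {0}"
  proof
    assume "W = {0}"
    then have "f x = f 0" if "x \<in> V" for x using fD(4)[OF that] fD(4)[OF subspace_0[OF sub]] by simp
    then have "x = 0" if "x \<in> V" for x using g(2)[OF that] g(2)[OF subspace_0[OF sub]] that by metis
    then show False using V(2) subspace_0[OF sub] by blast
  qed
  ultimately show ?thesis using W by (simp add: irreducible_form_module_def)
qed

text \<open>
  In a splitting each summand determines the other one. Hence an isometry that matches one pair of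
  summands also matches their complements.
\<close>

lemma orthogonal_complement_unique:
  assumes fm: "form_module H M L" and sp: "orthogonal_split H M L V U"
  shows "U = {y \<in> H. \<forall>x\<in>V. L x y = 0}"
proof (intro set_eqI iffI)
  fix y assume "y \<in> U"
  then show "y \<in> {y \<in> H. \<forall>x\<in>V. L x y = 0}"
    using sp orthogonal_split_parts[OF fm sp] by (auto simp: orthogonal_split_def orthogonal_wrt_def)
next
  note parts = orthogonal_split_parts[OF fm sp]
  fix y assume y: "y \<in> {y \<in> H. \<forall>x\<in>V. L x y = 0}"
  then obtain a b where ab: "y = a + b" "a \<in> V" "b \<in> U"
    using sp unfolding orthogonal_split_def direct_sum2_def by blast
  have "L x a = 0" if "x \<in> V" for x
  proof -
    have "L x y = L x a + L x b" using form_add_right[OF fm, of a b x] parts that ab by blast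
    moreover have "L x b = 0" using sp that ab(3) by (simp add: orthogonal_split_def orthogonal_wrt_def)
    ultimately show ?thesis using y that by simp
  qed
  then have "a = 0" using parts(3) ab(2) by (simp add: form_module_def nondegenerate_on_def)
  then show "y \<in> U" using ab by simp
qed

lemma isometry_maps_complement:
  assumes "form_module H M L" "form_module K M L" "form_isometry M L H K f"
    and "orthogonal_split H M L V U" "orthogonal_split K M L (f ` V) Z"
  shows "f ` U = Z"
  using orthogonal_complement_unique[OF assms(2,5)]
    orthogonal_complement_unique[OF assms(2) orthogonal_split_image[OF assms(1,3,4)]] by simp

text \<open>
  The isometry acts as \<open>v\<close> on \<open>Z\<close> and as the identity on \<open>W\<close>.
\<close>

lemma extend_isometry_by_identity:
  assumes fm: "form_module H M L" and sp: "orthogonal_split H M L W Z" and v: "form_isometry M L Z Z v"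
  obtains u where "form_isometry M L H H u" "\<And>x. x \<in> Z \<Longrightarrow> u x = v x"
proof -
  note sub = form_module_subspace[OF fm] and parts = orthogonal_split_parts[OF fm sp] and vD = form_isometryD[OF v]
  obtain e where e: "symmetric_op H M L e" "\<And>x. x \<in> Z \<Longrightarrow> e x = 0" "\<And>x. x \<in> H \<Longrightarrow> e x \<in> W"
    "\<And>x. x \<in> H \<Longrightarrow> x - e x \<in> Z"
    using orthogonal_split_projection[OF fm sp] by metis
  note eD = symmetric_opD[OF e(1)]
  have orth: "L x y = 0" "L y x = 0" if "x \<in> W" "y \<in> Z" for x y
    using sp that by (simp_all add: orthogonal_split_def orthogonal_wrt_def)
  have fd: "fin_dim_space H" and Mlin: "linear_on H M" using fm by (auto simp: form_module_def)
  define u where "u x = e x + v (x - e x)" for x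
  have vH: "v (x - e x) \<in> Z" if "x \<in> H" for x using vD(4) e(4) that by blast
  have lin: "linear_on H u" unfolding linear_on_def
  proof (intro conjI ballI allI)
    fix x y assume xy: "x \<in> H" "y \<in> H"
    have "x + y - e (x + y) = (x - e x) + (y - e y)" by (simp add: linear_add[OF eD(1)])
    then have "v (x + y - e (x + y)) = v (x - e x) + v (y - e y)"
      using vD(1) e(4)[OF xy(1)] e(4)[OF xy(2)] unfolding linear_on_def by metis
    then show "u (x + y) = u x + u y" by (simp add: u_def linear_add[OF eD(1)])
  next
    fix c x assume x: "x \<in> H"
    have "c *\<^sub>R x - e (c *\<^sub>R x) = c *\<^sub>R (x - e x)" by (simp add: linear_scale[OF eD(1)] scaleR_diff_right)
    then have "v (c *\<^sub>R x - e (c *\<^sub>R x)) = c *\<^sub>R v (x - e x)"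
      using vD(1) e(4)[OF x] unfolding linear_on_def by metis
    then show "u (c *\<^sub>R x) = c *\<^sub>R u x" by (simp add: u_def linear_scale[OF eD(1)] scaleR_add_right)
  qed
  have uH: "u ` H \<subseteq> H"
  proof -
    have "u x \<in> H" if "x \<in> H" for x
      unfolding u_def using subspace_add[OF sub eD(3)[OF that]] vH[OF that] parts(2) by blast
    then show ?thesis by blast
  qed
  have split_L: "L (a + b) (a' + b') = L a a' + L b b'" if "a \<in> W" "a' \<in> W" "b \<in> Z" "b' \<in> Z" for a a' b b'
  proof -
    have "a \<in> H" "a' \<in> H" "b \<in> H" "b' \<in> H" using that parts by auto
    then show ?thesis using that orth
      by (simp add: form_add_left[OF fm] form_add_right[OF fm] subspace_add[OF sub])
  qed
  have uL: "L (u x) (u y) = L x y" if "x \<in> H" "y \<in> H" for x y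
  proof -
    have "L (u x) (u y) = L (e x) (e y) + L (v (x - e x)) (v (y - e y))"
      unfolding u_def using split_L e(3) vH that by blast
    also have "\<dots> = L (e x) (e y) + L (x - e x) (y - e y)" using vD(6) e(4) that by simp
    also have "\<dots> = L (e x + (x - e x)) (e y + (y - e y))" using split_L e(3,4) that by metis
    finally show ?thesis by simp
  qed
  have uM: "u (M x) = M (u x)" if "x \<in> H" for x
  proof -
    have "M x - e (M x) = M (x - e x)"
      using eD(3,4) that linear_on_diff[OF sub Mlin] by simp
    then have "u (M x) = M (e x) + M (v (x - e x))" using vD(5) e(4) eD(4) that by (simp add: u_def)
    also have "\<dots> = M (u x)" using Mlin eD(3)[OF that] vH[OF that] parts(2) unfolding u_def linear_on_def by (simp add: subset_iff)
    finally show ?thesis .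
  qed
  have "x = 0" if "x \<in> H" "u x = 0" for x
  proof (rule form_eq_0[OF fm that(1)])
    fix y assume "y \<in> H"
    then show "L x y = 0" using uL[OF that(1)] that(2) form_zero(1)[OF fm] uH by (metis image_subset_iff)
  qed
  then have "bij_betw u H H" using injective_endomorphism_bij[OF fd lin uH] by blast
  then have "form_isometry M L H H u" using lin uL uM by (simp add: form_isometry_def)
  moreover have "u x = v x" if "x \<in> Z" for x using e(2)[OF that] by (simp add: u_def)
  ultimately show thesis using that by blast
qed

text \<open>
  The modular law: a summand \<open>V\<close> of \<open>H\<close> that lies in a summand \<open>W\<close> is a summand of \<open>W\<close>.
\<close>

lemma summand_of_larger_summand:
  assumes fm: "form_module H M L" and sp: "orthogonal_split H M L W Z" and V: "orthogonal_split H M L V U" and VW: "V \<subseteq> W"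
  shows "orthogonal_split W M L V (U \<inter> W)"
proof -
  have sW: "subspace W" and MW: "M ` W \<subseteq> W" using sp by (auto simp: orthogonal_split_def direct_sum2_def)
  have sV: "subspace V" and sU: "subspace U" and VU: "V \<inter> U = {0}"
    and HVU: "H = {x + y |x y. x \<in> V \<and> y \<in> U}" and orth: "orthogonal_wrt L V U"
    and MV: "M ` V \<subseteq> V" and MU: "M ` U \<subseteq> U"
    using V by (simp_all add: orthogonal_split_def direct_sum2_def)
  have "\<exists>x y. w = x + y \<and> x \<in> V \<and> y \<in> U \<inter> W" if "w \<in> W" for w
  proof -
    have "w \<in> H" using that orthogonal_split_parts(1)[OF fm sp] by blast
    then obtain x y where xy: "w = x + y" "x \<in> V" "y \<in> U" using HVU by blast
    then have "y = w - x" by simp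
    then have "y \<in> W" using subspace_diff[OF sW that] xy(2) VW by blast
    then show ?thesis using xy by blast
  qed
  then have "W = {x + y |x y. x \<in> V \<and> y \<in> U \<inter> W}"
    using VW subspace_add[OF sW] by blast
  moreover have "V \<inter> (U \<inter> W) = {0}" using VU VW by blast
  moreover have "subspace (U \<inter> W)" using subspace_inter[OF sU sW] .
  moreover have "orthogonal_wrt L V (U \<inter> W)" using orth by (simp add: orthogonal_wrt_def)
  ultimately show ?thesis using sV MV MU MW unfolding orthogonal_split_def direct_sum2_def by blast
qed

section \<open>Orthogonal families of irreducible summands\<close>

text \<open>
  Orthogonality and nondegeneracy of the members make the sum direct, so asking for the span suffices
  (see \<open>irreducible_family_direct_sum\<close>). Arbitrary index sets make it easy to
  remove a member and to use a set of subspaces as its own index set.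
\<close>

definition irreducible_family ::
    "'a::real_vector set \<Rightarrow> ('a \<Rightarrow> 'a) \<Rightarrow> ('a \<Rightarrow> 'a \<Rightarrow> real) \<Rightarrow> 'i set \<Rightarrow> ('i \<Rightarrow> 'a set) \<Rightarrow> bool" where
  "irreducible_family H M L I V \<longleftrightarrow> finite I \<and> (\<forall>i\<in>I. irreducible_form_module (V i) M L) \<and>
     (\<forall>i\<in>I. \<forall>j\<in>I. i \<noteq> j \<longrightarrow> orthogonal_wrt L (V i) (V j)) \<and> H = span (\<Union>i\<in>I. V i)"

lemma irreducible_family_insert:
  assumes fm: "form_module H M L" and fam: "irreducible_family H M L (insert i I) V" and i: "i \<notin> I"
  shows "orthogonal_split H M L (V i) (span (\<Union>i\<in>I. V i))"
    and "irreducible_family (span (\<Union>i\<in>I. V i)) M L I V"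
proof -
  let ?Z = "span (\<Union>i\<in>I. V i)"
  note sub = form_module_subspace[OF fm]
  have irr: "irreducible_form_module (V j) M L" if "j \<in> insert i I" for j
    using fam that unfolding irreducible_family_def by blast
  have mod: "form_module (V j) M L" if "j \<in> insert i I" for j
    using irr[OF that] by (simp add: irreducible_form_module_def)
  note sV = form_module_subspace[OF mod]
  have HU: "H = span (V i \<union> (\<Union>i\<in>I. V i))" using fam by (simp add: irreducible_family_def)
  then have VH: "V i \<subseteq> H" and UH: "(\<Union>i\<in>I. V i) \<subseteq> H"
    using span_superset[of "V i \<union> (\<Union>i\<in>I. V i)"] by simp_all
  have ZH: "?Z \<subseteq> H" using span_minimal[OF UH sub] .
  have orth: "L x z = 0 \<and> L z x = 0" if "x \<in> V i" "z \<in> ?Z" for x z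
  proof -
    have x: "x \<in> H" using that(1) VH by blast
    have "(\<Union>i\<in>I. V i) \<subseteq> {z \<in> H. L x z = 0 \<and> L z x = 0}"
    proof
      fix z assume z: "z \<in> (\<Union>i\<in>I. V i)"
      then obtain j where j: "j \<in> I" "z \<in> V j" by blast
      then have "orthogonal_wrt L (V i) (V j)" using fam i by (auto simp: irreducible_family_def)
      then have "L x z = 0 \<and> L z x = 0" using that(1) j(2) by (simp add: orthogonal_wrt_def)
      then show "z \<in> {z \<in> H. L x z = 0 \<and> L z x = 0}" using z UH by blast
    qed
    moreover have "subspace {z \<in> H. L x z = 0 \<and> L z x = 0}"
      using x subspace_0[OF sub] form_zero[OF fm x]
      by (auto simp: subspace_def form_add_left[OF fm] form_add_right[OF fm] form_scale_left[OF fm] form_scale_right[OF fm]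
          subspace_add[OF sub] subspace_scale[OF sub])
    ultimately have "?Z \<subseteq> {z \<in> H. L x z = 0 \<and> L z x = 0}" by (rule span_minimal)
    then show ?thesis using that(2) by blast
  qed
  have "x = 0" if "x \<in> V i" "x \<in> ?Z" for x
    by (rule form_eq_0[OF mod[of i]]) (use orth that in auto)
  then have "V i \<inter> ?Z = {0}" using subspace_0[OF sV[of i]] span_zero by auto
  moreover have "H = {x + y |x y. x \<in> V i \<and> y \<in> ?Z}"
  proof -
    have Vi: "span (V i) = V i" using sV[of i] by simp
    show ?thesis unfolding HU span_Un Vi ..
  qed
  moreover have "M ` ?Z \<subseteq> ?Z"
  proof -
    have Mlin: "linear_on H M" using fm by (simp add: form_module_def)
    have "(\<Union>i\<in>I. V i) \<subseteq> {z \<in> H. M z \<in> ?Z}"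
    proof
      fix z assume z: "z \<in> (\<Union>i\<in>I. V i)"
      then obtain j where j: "j \<in> I" "z \<in> V j" by blast
      then have "M z \<in> V j" using mod[of j] by (auto simp: form_module_def)
      then have "M z \<in> ?Z" using j(1) by (intro span_base) blast
      then show "z \<in> {z \<in> H. M z \<in> ?Z}" using z UH by blast
    qed
    moreover have "subspace {z \<in> H. M z \<in> ?Z}"
      using Mlin linear_on_0[OF sub Mlin] subspace_0[OF sub]
      by (auto simp: subspace_def linear_on_def span_add span_scale span_zero subspace_add[OF sub] subspace_scale[OF sub])
    ultimately have "?Z \<subseteq> {z \<in> H. M z \<in> ?Z}" by (rule span_minimal)
    then show ?thesis by blast
  qed
  moreover have "M ` V i \<subseteq> V i" using mod[of i] by (simp add: form_module_def)
  moreover have "orthogonal_wrt L (V i) ?Z" using orth by (simp add: orthogonal_wrt_def)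
  ultimately show "orthogonal_split H M L (V i) ?Z"
    using sV[of i] by (simp add: orthogonal_split_def direct_sum2_def)
  show "irreducible_family ?Z M L I V"
    using fam unfolding irreducible_family_def by simp
qed

text \<open>
  Split off one member \<open>W j\<close>. If \<open>V\<close> can be moved into \<open>W j\<close>, irreducibility of \<open>W j\<close> forces equality.
  Otherwise \<open>V\<close> can be moved into the span of the other members, where the induction hypothesis moves it
  further; that second isometry is extended by the identity on \<open>W j\<close>.
\<close>

lemma move_irreducible_onto_member:
  assumes "finite J" "form_module H M L" "irreducible_family H M L J W"
    and "orthogonal_split H M L V U" "irreducible_form_module V M L"
  shows "\<exists>u j. form_isometry M L H H u \<and> j \<in> J \<and> u ` V = W j"
  using assms
proof (induction J arbitrary: H V U rule: finite_induct)
  case empty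
  then have "H = {0}" by (simp add: irreducible_family_def)
  moreover have "V \<subseteq> H" "subspace V" using orthogonal_split_parts(1,3)[OF empty(1,3)] form_module_subspace by blast+
  ultimately have "V = {0}" using subspace_0 by blast
  then show ?case using empty(4) by (simp add: irreducible_form_module_def)
next
  case (insert j J)
  note fm = insert.prems(1)
  define Z where "Z = span (\<Union>i\<in>J. W i)"
  have sp: "orthogonal_split H M L (W j) Z" and famZ: "irreducible_family Z M L J W"
    using irreducible_family_insert[OF fm insert.prems(2) insert.hyps(2)] by (simp_all add: Z_def)
  obtain u where u: "form_isometry M L H H u" "u ` V \<subseteq> W j \<or> u ` V \<subseteq> Z"
    using move_irreducible_into_summand[OF fm insert.prems(3,4) sp] by metis
  have uV: "orthogonal_split H M L (u ` V) (u ` U)"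
    using orthogonal_split_image[OF fm u(1) insert.prems(3)] .
  have VH: "V \<subseteq> H" using orthogonal_split_parts(1)[OF fm insert.prems(3)] .
  have irr: "irreducible_form_module (u ` V) M L"
    by (rule irreducible_image[OF insert.prems(4) form_isometry_restrict[OF u(1) VH] orthogonal_split_parts(3)[OF fm uV]])
  from u(2) show ?case
  proof
    assume sub: "u ` V \<subseteq> W j"
    have s: "orthogonal_split (W j) M L (u ` V) (u ` U \<inter> W j)"
      by (rule summand_of_larger_summand[OF fm sp uV sub])
    have "irreducible_form_module (W j) M L" using insert.prems(2) by (simp add: irreducible_family_def)
    then have "u ` V = {0} \<or> u ` U \<inter> W j = {0}" using s unfolding irreducible_form_module_def by blast
    then have "u ` U \<inter> W j = {0}" using irr by (simp add: irreducible_form_module_def)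
    then have "W j = u ` V" using s by (auto simp: orthogonal_split_def direct_sum2_def)
    then show ?case using u(1) by blast
  next
    assume sub: "u ` V \<subseteq> Z"
    have Z: "form_module Z M L" using orthogonal_split_parts[OF fm sp] by blast
    have sp': "orthogonal_split H M L Z (W j)" using orthogonal_split_commute[OF sp] .
    obtain v k where v: "form_isometry M L Z Z v" "k \<in> J" "v ` u ` V = W k"
      using insert.IH[OF Z famZ summand_of_larger_summand[OF fm sp' uV sub] irr] by metis
    obtain w where w: "form_isometry M L H H w" "\<And>x. x \<in> Z \<Longrightarrow> w x = v x"
      using extend_isometry_by_identity[OF fm sp v(1)] by metis
    have "(\<lambda>x. w (u x)) ` V = v ` u ` V" unfolding image_image using w(2) sub by (intro image_cong) auto
    then show ?case using form_isometry_comp[OF u(1) w(1)] v(2,3) by auto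
  qed
qed

text \<open>
  The statement is about two isometric spaces rather than one, because after a member \<open>V i\<close> has been
  moved onto some \<open>W j\<close>, what remains to be compared are the spans of the other members, which are
  complements of \<open>V i\<close> and \<open>W j\<close>: these are isometric but need not be equal.
\<close>

lemma irreducible_family_unique:
  assumes "finite I" "form_module H M L" "form_module K M L" "form_isometry M L H K f"
    and "irreducible_family H M L I V" "irreducible_family K M L J W"
  shows "\<exists>\<sigma>. bij_betw \<sigma> I J \<and> (\<forall>i\<in>I. \<exists>g. form_isometry M L (V i) (W (\<sigma> i)) g)"
  using assms
proof (induction I arbitrary: H K f J rule: finite_induct)
  case empty
  have "H = {0}" using empty by (simp add: irreducible_family_def)
  then have K: "K = {0}"
    using form_isometryD(1,3)[OF empty(3)] linear_on_0[OF form_module_subspace[OF empty(1)]] by auto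
  have "J = {}"
  proof (rule ccontr)
    assume "J \<noteq> {}"
    then obtain j where j: "j \<in> J" by blast
    then have irr: "irreducible_form_module (W j) M L" and "W j \<subseteq> K"
      using empty(5) by (auto simp: irreducible_family_def intro: span_base)
    then have "W j \<subseteq> {0}" using K by simp
    moreover have "0 \<in> W j" using irr form_module_subspace subspace_0 unfolding irreducible_form_module_def by blast
    ultimately show False using irr unfolding irreducible_form_module_def by blast
  qed
  then show ?case by (simp add: bij_betw_def)
next
  case (insert i I)
  note H = insert.prems(1) and K = insert.prems(2) and f = insert.prems(3)
  define H' where "H' = span (\<Union>i\<in>I. V i)"
  have sp: "orthogonal_split H M L (V i) H'" and famH: "irreducible_family H' M L I V"
    using irreducible_family_insert[OF H insert.prems(4) insert.hyps(2)] by (simp_all add: H'_def)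
  note partsH = orthogonal_split_parts[OF H sp]
  have spf: "orthogonal_split K M L (f ` V i) (f ` H')" using orthogonal_split_image[OF H f sp] .
  have "irreducible_form_module (V i) M L" using insert.prems(4) by (simp add: irreducible_family_def)
  then have irr: "irreducible_form_module (f ` V i) M L"
    by (rule irreducible_image[OF _ form_isometry_restrict[OF f partsH(1)] orthogonal_split_parts(3)[OF K spf]])
  have "finite J" using insert.prems(5) by (simp add: irreducible_family_def)
  then obtain u j where u: "form_isometry M L K K u" "j \<in> J" "u ` f ` V i = W j"
    using move_irreducible_onto_member[OF _ K insert.prems(5) spf irr] by blast
  define g where "g x = u (f x)" for x
  have g: "form_isometry M L H K g" unfolding g_def by (rule form_isometry_comp[OF f u(1)])
  have gV: "g ` V i = W j" using u(3) by (simp add: g_def image_image)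
  define K' where "K' = span (\<Union>i\<in>J - {j}. W i)"
  have Jj: "insert j (J - {j}) = J" using u(2) by blast
  have spK: "orthogonal_split K M L (W j) K'" and famK: "irreducible_family K' M L (J - {j}) W"
    using irreducible_family_insert[OF K, of j "J - {j}" W, unfolded Jj, OF insert.prems(5)] by (simp_all add: K'_def)
  have gH': "g ` H' = K'" using isometry_maps_complement[OF H K g sp] spK gV by simp
  have "form_isometry M L H' K' g" using form_isometry_restrict[OF g partsH(2)] gH' by simp
  from insert.IH[OF partsH(4) orthogonal_split_parts(4)[OF K spK] this famH famK]
  obtain \<sigma> where \<sigma>: "bij_betw \<sigma> I (J - {j})" "\<forall>i\<in>I. \<exists>g. form_isometry M L (V i) (W (\<sigma> i)) g" by blast
  let ?\<tau> = "\<lambda>k. if k = i then j else \<sigma> k"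
  have "bij_betw ?\<tau> I (J - {j}) \<longleftrightarrow> bij_betw \<sigma> I (J - {j})"
    by (rule bij_betw_cong) (use insert.hyps(2) in auto)
  then have "bij_betw ?\<tau> I (J - {j})" using \<sigma>(1) by blast
  moreover have "bij_betw ?\<tau> {i} {j}" by (simp add: bij_betw_def)
  ultimately have "bij_betw ?\<tau> ({i} \<union> I) ({j} \<union> (J - {j}))" by (intro bij_betw_combine) auto
  then have "bij_betw ?\<tau> (insert i I) J" using Jj by simp
  moreover have "form_isometry M L (V i) (W j) g" using form_isometry_restrict[OF g partsH(1)] gV by simp
  then have "\<forall>k\<in>insert i I. \<exists>g. form_isometry M L (V k) (W (?\<tau> k)) g" using \<sigma>(2) by auto
  ultimately show ?case by (intro exI[of _ ?\<tau>] conjI)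
qed


lemma proper_subspace_smaller_basis:
  assumes V: "subspace V" "V \<subset> span B" and B: "finite B"
  obtains C where "finite C" "card C < card B" "span C = V"
proof -
  obtain C where C: "C \<subseteq> V" "independent C" "V \<subseteq> span C" by (rule maximal_independent_subset)
  have span: "span C = V" using span_minimal[OF C(1) V(1)] C(3) by blast
  obtain x where x: "x \<in> span B" "x \<notin> V" using V(2) by blast
  have "independent (insert x C)" using independent_insertI[of x C] C(2) x(2) span by blast
  moreover have "insert x C \<subseteq> span B" using x(1) C(1) V(2) by blast
  ultimately have "finite (insert x C)" "card (insert x C) \<le> card B"
    using independent_span_bound[OF B, of "insert x C"] by simp_all
  moreover have "x \<notin> C" using C(1) x(2) by blast
  ultimately show thesis using that[OF _ _ span] by simp
qed

text \<open>
  The family is a set of subspaces indexed by itself, so that the two families from the halves of a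
  splitting are simply united.
\<close>

lemma irreducible_family_exists:
  assumes "form_module H M L"
  shows "\<exists>F. irreducible_family H M L F (\<lambda>X. X)"
proof -
  obtain B where "finite B" "span B = H" using assms by (auto simp: form_module_def fin_dim_space_def)
  then show ?thesis using assms
  proof (induction "card B" arbitrary: B H rule: less_induct)
    case less
    note fm = less.prems(3) and sub = form_module_subspace[OF less.prems(3)]
    consider "H = {0}" | "irreducible_form_module H M L" | "H \<noteq> {0}" "\<not> irreducible_form_module H M L" by blast
    then show ?case
    proof cases
      case 1
      then show ?thesis by (intro exI[of _ "{}"]) (simp add: irreducible_family_def)
    next
      case 2
      moreover have "span H = H" using sub by simp
      ultimately show ?thesis
        by (intro exI[of _ "{H}"]) (simp add: irreducible_family_def del: span_eq_iff)
    next
      case 3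
      then obtain V U where sp: "orthogonal_split H M L V U" and nz: "V \<noteq> {0}" "U \<noteq> {0}"
        using fm by (auto simp: irreducible_form_module_def)
      note parts = orthogonal_split_parts[OF fm sp]
      have VU: "V \<inter> U = {0}" "H = {x + y |x y. x \<in> V \<and> y \<in> U}" "orthogonal_wrt L V U"
        using sp by (simp_all add: orthogonal_split_def direct_sum2_def)
      have "V \<noteq> H" using VU(1) nz parts by auto
      moreover have "U \<noteq> H" using VU(1) nz parts by auto
      ultimately have proper: "V \<subset> span B" "U \<subset> span B" using parts(1,2) less.prems(2) by auto
      obtain C where C: "finite C" "card C < card B" "span C = V"
        using proper_subspace_smaller_basis[OF form_module_subspace[OF parts(3)] proper(1) less.prems(1)] by metis
      obtain D where D: "finite D" "card D < card B" "span D = U"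
        using proper_subspace_smaller_basis[OF form_module_subspace[OF parts(4)] proper(2) less.prems(1)] by metis
      obtain F where F: "irreducible_family V M L F (\<lambda>X. X)"
        using less.hyps[OF C(2,1,3) parts(3)] by blast
      obtain G where G: "irreducible_family U M L G (\<lambda>X. X)"
        using less.hyps[OF D(2,1,3) parts(4)] by blast
      have FV: "X \<subseteq> V" if "X \<in> F" for X
        using F that span_superset[of "\<Union>F"] by (auto simp: irreducible_family_def)
      have GU: "X \<subseteq> U" if "X \<in> G" for X
        using G that span_superset[of "\<Union>G"] by (auto simp: irreducible_family_def)
      have orthFG: "orthogonal_wrt L X Y" "orthogonal_wrt L Y X" if "X \<in> F" "Y \<in> G" for X Y
      proof -
        have "L x y = 0 \<and> L y x = 0" if "x \<in> X" "y \<in> Y" for x y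
          using VU(3) FV[OF \<open>X \<in> F\<close>] GU[OF \<open>Y \<in> G\<close>] that by (simp add: orthogonal_wrt_def subset_iff)
        then show "orthogonal_wrt L X Y" "orthogonal_wrt L Y X" by (simp_all add: orthogonal_wrt_def)
      qed
      have "span (\<Union>(F \<union> G)) = H"
        using F G VU(2) by (simp add: irreducible_family_def span_Un)
      moreover have "orthogonal_wrt L X Y" if "X \<in> F \<union> G" "Y \<in> F \<union> G" "X \<noteq> Y" for X Y
        using that(1,2)
      proof (elim UnE)
        show "orthogonal_wrt L X Y" if "X \<in> F" "Y \<in> F" using F that \<open>X \<noteq> Y\<close> by (simp add: irreducible_family_def)
        show "orthogonal_wrt L X Y" if "X \<in> G" "Y \<in> G" using G that \<open>X \<noteq> Y\<close> by (simp add: irreducible_family_def)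
      qed (simp_all add: orthFG)
      moreover have "irreducible_form_module X M L" if "X \<in> F \<union> G" for X
        using that F G by (auto simp: irreducible_family_def)
      moreover have "finite (F \<union> G)" using F G by (simp add: irreducible_family_def)
      ultimately have "irreducible_family H M L (F \<union> G) (\<lambda>X. X)"
        unfolding irreducible_family_def by simp
      then show ?thesis by blast
    qed
  qed
qed

lemma irreducible_family_direct_sum:
  assumes fm: "form_module H M L" and fam: "irreducible_family H M L {..<n} V"
  shows "direct_sum_decomp H n V"
proof -
  note sub = form_module_subspace[OF fm]
  have irr: "irreducible_form_module (V i) M L" if "i < n" for i
    using fam that by (simp add: irreducible_family_def)
  have mod: "form_module (V i) M L" if "i < n" for i
    using irr[OF that] by (simp add: irreducible_form_module_def)
  have sV: "subspace (V i)" if "i < n" for i using form_module_subspace[OF mod[OF that]] .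
  have HV: "H = span (\<Union>i<n. V i)" using fam by (simp add: irreducible_family_def)
  have VH: "x \<in> H" if "i < n" "x \<in> V i" for i x
    unfolding HV using that by (intro span_base) blast
  have orth: "L x y = 0" if "i < n" "j < n" "i \<noteq> j" "x \<in> V i" "y \<in> V j" for i j x y
    using fam that by (simp add: irreducible_family_def orthogonal_wrt_def)
  let ?s = "\<lambda>v. \<Sum>i<n. v i"
  have inj: "inj_on ?s (Pi\<^sub>E {..<n} V)"
  proof (rule inj_onI)
    fix v w assume v: "v \<in> Pi\<^sub>E {..<n} V" and w: "w \<in> Pi\<^sub>E {..<n} V" and eq: "?s v = ?s w"
    define d where "d i = v i - w i" for i
    have d: "d i \<in> V i" if "i < n" for i
      using v w that subspace_diff[OF sV[OF that]] by (auto simp: d_def PiE_iff)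
    have "d k = 0" if k: "k < n" for k
    proof (rule form_eq_0[OF mod[OF k] d[OF k]])
      fix y assume y: "y \<in> V k"
      have yH: "y \<in> H" using VH[OF k y] .
      then have "linear_on H (\<lambda>x. L x y)" using fm by (simp add: form_module_def bilinear_form_on_def)
      then obtain g where g: "linear g" "\<And>x. x \<in> H \<Longrightarrow> g x = L x y" using linear_on_extend[OF sub] by blast
      have "(\<Sum>i<n. d i) = 0" using eq by (simp add: d_def sum_subtractf)
      then have "0 = (\<Sum>i<n. g (d i))" using linear_0[OF g(1)] linear_sum[OF g(1)] by metis
      also have "\<dots> = (\<Sum>i<n. if i = k then L (d k) y else 0)"
        using g(2) VH d orth[OF _ k _ d y] by (intro sum.cong) auto
      also have "\<dots> = L (d k) y" using k by simp
      finally show "L (d k) y = 0" by simp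
    qed
    then have "v i = w i" if "i < n" for i using that by (simp add: d_def)
    then show "v = w" using v w by (intro PiE_ext) auto
  qed
  have "subspace (?s ` Pi\<^sub>E {..<n} V)"
  proof (rule subspaceI)
    show "0 \<in> ?s ` Pi\<^sub>E {..<n} V"
      by (rule image_eqI[of _ _ "\<lambda>i\<in>{..<n}. 0"]) (auto simp: subspace_0 sV)
  next
    fix x y assume "x \<in> ?s ` Pi\<^sub>E {..<n} V" "y \<in> ?s ` Pi\<^sub>E {..<n} V"
    then obtain v w where vw: "v \<in> Pi\<^sub>E {..<n} V" "w \<in> Pi\<^sub>E {..<n} V" "x = ?s v" "y = ?s w" by blast
    then show "x + y \<in> ?s ` Pi\<^sub>E {..<n} V"
      by (intro image_eqI[of _ _ "\<lambda>i\<in>{..<n}. v i + w i"]) (auto simp: sum.distrib PiE_iff intro!: subspace_add sV)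
  next
    fix c x assume "x \<in> ?s ` Pi\<^sub>E {..<n} V"
    then obtain v where v: "v \<in> Pi\<^sub>E {..<n} V" "x = ?s v" by blast
    then show "c *\<^sub>R x \<in> ?s ` Pi\<^sub>E {..<n} V"
      by (intro image_eqI[of _ _ "\<lambda>i\<in>{..<n}. c *\<^sub>R v i"]) (auto simp: scaleR_sum_right PiE_iff intro!: subspace_scale sV)
  qed
  moreover have "(\<Union>i<n. V i) \<subseteq> ?s ` Pi\<^sub>E {..<n} V"
  proof
    fix x assume "x \<in> (\<Union>i<n. V i)"
    then obtain k where k: "k < n" "x \<in> V k" by blast
    then show "x \<in> ?s ` Pi\<^sub>E {..<n} V"
      by (intro image_eqI[of _ _ "\<lambda>i\<in>{..<n}. if i = k then x else 0"]) (auto simp: subspace_0 sV)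
  qed
  ultimately have "H \<subseteq> ?s ` Pi\<^sub>E {..<n} V" unfolding HV by (intro span_minimal)
  moreover have "?s ` Pi\<^sub>E {..<n} V \<subseteq> H"
  proof
    fix x assume "x \<in> ?s ` Pi\<^sub>E {..<n} V"
    then obtain v where "v \<in> Pi\<^sub>E {..<n} V" "x = ?s v" by blast
    then show "x \<in> H" using VH by (auto simp: PiE_iff intro!: subspace_sum[OF sub])
  qed
  ultimately show ?thesis using inj sV by (auto simp: direct_sum_decomp_def bij_betw_def)
qed

lemma direct_sum_decomp_span:
  assumes H: "subspace H" and ds: "direct_sum_decomp H n V"
  shows "H = span (\<Union>i<n. V i)"
proof -
  let ?s = "\<lambda>v. \<Sum>i<n. v i"
  have sV: "subspace (V i)" if "i < n" for i using ds that by (simp add: direct_sum_decomp_def)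
  have im: "?s ` Pi\<^sub>E {..<n} V = H" using ds by (simp add: direct_sum_decomp_def bij_betw_def)
  have "x \<in> H" if "k < n" "x \<in> V k" for k x
    unfolding im[symmetric] using that
    by (intro image_eqI[of _ _ "\<lambda>i\<in>{..<n}. if i = k then x else 0"]) (auto simp: subspace_0 sV)
  then have "span (\<Union>i<n. V i) \<subseteq> H" by (intro span_minimal[OF _ H]) blast
  moreover have "?s v \<in> span (\<Union>i<n. V i)" if "v \<in> Pi\<^sub>E {..<n} V" for v
  proof (rule span_sum)
    fix i assume "i \<in> {..<n}"
    then show "v i \<in> span (\<Union>i<n. V i)" using that by (intro span_base) auto
  qed
  ultimately show ?thesis using im by blast
qed

lemma irreducible_decomposition_exists:
  assumes fm: "form_module H M L"
  shows "\<exists>n V. direct_sum_decomp H n V \<and> irreducible_family H M L {..<n} V"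
proof -
  obtain F where F: "irreducible_family H M L F (\<lambda>X. X)" using irreducible_family_exists[OF fm] by blast
  then have "finite F" by (simp add: irreducible_family_def)
  then obtain V where V: "bij_betw V {..<card F} F"
    using ex_bij_betw_nat_finite[of F] by (auto simp: atLeast0LessThan)
  then have im: "V ` {..<card F} = F" and inj: "inj_on V {..<card F}" by (simp_all add: bij_betw_def)
  have "V i \<in> F" if "i < card F" for i using im that by blast
  moreover have "V i \<noteq> V j" if "i < card F" "j < card F" "i \<noteq> j" for i j
    using inj_onD[OF inj, of i j] that by auto
  ultimately have "irreducible_family H M L {..<card F} V"
    using F im by (simp add: irreducible_family_def)
  then show ?thesis using irreducible_family_direct_sum[OF fm] by blast
qed

lemma irreducible_decomposition_unique:
  fixes n k :: nat
  assumes fm: "form_module H M L"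
    and "irreducible_family H M L {..<n} V" "irreducible_family H M L {..<k} W"
  shows "\<exists>\<sigma>. bij_betw \<sigma> {..<n} {..<k} \<and> (\<forall>i<n. \<exists>g. form_isometry M L (V i) (W (\<sigma> i)) g)"
proof -
  have "form_isometry M L H H (\<lambda>x. x)"
    by (simp add: form_isometry_def linear_on_def bij_betw_def)
  from irreducible_family_unique[OF finite_lessThan fm fm this assms(2,3)] show ?thesis
    unfolding lessThan_iff Ball_def .
qed

lemma irreducible_family_decomp_iff:
  assumes fm: "form_module H M L"
  shows "irreducible_family H M L {..<n} V \<longleftrightarrow> direct_sum_decomp H n V \<and>
    (\<forall>i<n. \<forall>j<n. i \<noteq> j \<longrightarrow> orthogonal_wrt L (V i) (V j)) \<and> (\<forall>i<n. irreducible_form_module (V i) M L)"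
proof -
  have "irreducible_family H M L {..<n} V \<longleftrightarrow> (\<forall>i<n. irreducible_form_module (V i) M L) \<and>
      (\<forall>i<n. \<forall>j<n. i \<noteq> j \<longrightarrow> orthogonal_wrt L (V i) (V j)) \<and> H = span (\<Union>i<n. V i)"
    unfolding irreducible_family_def lessThan_iff Ball_def using finite_lessThan by blast
  then show ?thesis
    using irreducible_family_direct_sum[OF fm, of n V] direct_sum_decomp_span[OF form_module_subspace[OF fm], of n V]
    by blast
qed

section \<open>Isometric triples and Seifert form pairs\<close>

lemma isometric_triple_form_module: "isometric_triple H M S \<Longrightarrow> form_module H M S"
  by (auto simp: isometric_triple_def form_module_def bij_betw_def)

text \<open>
  Only bijectivity of \<open>M\<close> needs an argument: \<open>M\<close> is injective on \<open>V\<close>, and \<open>V\<close> is finite dimensional.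
\<close>

lemma isometric_triple_subspace:
  assumes H: "isometric_triple H M S" and V: "form_module V M S" "V \<subseteq> H"
  shows "isometric_triple V M S"
proof -
  have inj: "inj_on M H" and Mlin: "linear_on H M" and sub: "subspace H"
    using H by (auto simp: isometric_triple_def bij_betw_def fin_dim_space_def)
  have V': "fin_dim_space V" "linear_on V M" "M ` V \<subseteq> V" "bilinear_form_on V S" "nondegenerate_on V S"
    using V by (simp_all add: form_module_def)
  have "x = 0" if "x \<in> V" "M x = 0" for x
    using inj_onD[OF inj, of x 0] that V(2) linear_on_0[OF sub Mlin] subspace_0[OF sub] by auto
  then have "bij_betw M V V" using injective_endomorphism_bij V' by blast
  moreover have "\<exists>m\<in>{0, 1::nat}. \<forall>a\<in>V. \<forall>b\<in>V. S b a = (-1) ^ m * S a b"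
    using H V(2) unfolding isometric_triple_def by (meson subsetD)
  moreover have "\<forall>a\<in>V. \<forall>b\<in>V. S (M a) (M b) = S a b"
    using H V(2) unfolding isometric_triple_def by (meson subsetD)
  ultimately show ?thesis using V' by (simp add: isometric_triple_def)
qed

lemma irreducible_isometric_triple_iff:
  assumes "isometric_triple H M S" "V \<subseteq> H"
  shows "irreducible_isometric_triple V M S \<longleftrightarrow> irreducible_form_module V M S"
  using isometric_triple_form_module[of V M S] isometric_triple_subspace[OF assms(1) _ assms(2)]
  unfolding irreducible_isometric_triple_def irreducible_form_module_def orthogonal_split_def by blast

lemma seifert_form_pair_iff: "seifert_form_pair H L \<longleftrightarrow> form_module H (\<lambda>x. x) L"
  by (auto simp: seifert_form_pair_def form_module_def linear_on_def)

lemma irreducible_seifert_form_pair_iff: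
  "irreducible_seifert_form_pair V L \<longleftrightarrow> irreducible_form_module V (\<lambda>x. x) L"
  unfolding irreducible_seifert_form_pair_def irreducible_form_module_def orthogonal_split_def seifert_form_pair_iff
  by simp blast

lemma irreducible_triple_splitting_iff:
  assumes H: "isometric_triple H M S"
  shows "irreducible_triple_splitting H M S n V \<longleftrightarrow> irreducible_family H M S {..<n} V"
proof -
  note fm = isometric_triple_form_module[OF H]
  show ?thesis
  proof (cases "direct_sum_decomp H n V")
    case True
    have "V i \<subseteq> H" if "i < n" for i
      unfolding direct_sum_decomp_span[OF form_module_subspace[OF fm] True] using that by (auto intro: span_base)
    then have iff: "irreducible_isometric_triple (V i) M S \<longleftrightarrow> irreducible_form_module (V i) M S" if "i < n" for i
      using irreducible_isometric_triple_iff[OF H, of "V i"] that by simp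
    have "M ` V i \<subseteq> V i" if "irreducible_form_module (V i) M S" for i
      using that by (simp add: irreducible_form_module_def form_module_def)
    then show ?thesis
      unfolding irreducible_triple_splitting_def irreducible_family_decomp_iff[OF fm] by (simp add: iff) blast
  next
    case False
    then show ?thesis
      unfolding irreducible_triple_splitting_def irreducible_family_decomp_iff[OF fm] by simp
  qed
qed

lemma irreducible_seifert_splitting_iff:
  assumes "seifert_form_pair H L"
  shows "irreducible_seifert_splitting H L n V \<longleftrightarrow> irreducible_family H (\<lambda>x. x) L {..<n} V"
  using assms unfolding irreducible_seifert_splitting_def seifert_form_pair_iff irreducible_seifert_form_pair_iff
  by (simp add: irreducible_family_decomp_iff)

theorem theorem2p5:
  shows "(\<forall>(H :: 'a::real_vector set) M S. isometric_triple H M S \<longrightarrow>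
            (\<exists>n V. irreducible_triple_splitting H M S n V) \<and>
            (\<forall>n V k W.
               irreducible_triple_splitting H M S n V \<and> irreducible_triple_splitting H M S k W \<longrightarrow>
               (\<exists>\<sigma>. bij_betw \<sigma> {..<n} {..<k} \<and>
                    (\<forall>i<n. isometric_triple_iso (V i) M S (W (\<sigma> i)) M S)))) \<and>
         (\<forall>(H :: 'a set) L. seifert_form_pair H L \<longrightarrow>
            (\<exists>n V. irreducible_seifert_splitting H L n V) \<and>
            (\<forall>n V k W.
               irreducible_seifert_splitting H L n V \<and> irreducible_seifert_splitting H L k W \<longrightarrow>
               (\<exists>\<sigma>. bij_betw \<sigma> {..<n} {..<k} \<and>
                    (\<forall>i<n. seifert_form_pair_iso (V i) L (W (\<sigma> i)) L))))"
proof (intro conjI allI impI)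
  fix H :: "'a set" and M S
  assume H: "isometric_triple H M S"
  note fm = isometric_triple_form_module[OF H]
  show "\<exists>n V. irreducible_triple_splitting H M S n V"
    using irreducible_decomposition_exists[OF fm] irreducible_triple_splitting_iff[OF H] by blast
  fix n V k W
  assume "irreducible_triple_splitting H M S n V \<and> irreducible_triple_splitting H M S k W"
  then show "\<exists>\<sigma>. bij_betw \<sigma> {..<n} {..<k} \<and> (\<forall>i<n. isometric_triple_iso (V i) M S (W (\<sigma> i)) M S)"
    using irreducible_decomposition_unique[OF fm, of n V k W]
    unfolding irreducible_triple_splitting_iff[OF H] isometric_triple_iso_def form_isometry_def by blast
next
  fix H :: "'a set" and L
  assume H: "seifert_form_pair H L"
  then have fm: "form_module H (\<lambda>x. x) L" by (simp add: seifert_form_pair_iff)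
  show "\<exists>n V. irreducible_seifert_splitting H L n V"
    using irreducible_decomposition_exists[OF fm] irreducible_seifert_splitting_iff[OF H] by blast
  fix n V k W
  assume "irreducible_seifert_splitting H L n V \<and> irreducible_seifert_splitting H L k W"
  then show "\<exists>\<sigma>. bij_betw \<sigma> {..<n} {..<k} \<and> (\<forall>i<n. seifert_form_pair_iso (V i) L (W (\<sigma> i)) L)"
    using irreducible_decomposition_unique[OF fm, of n V k W]
    unfolding irreducible_seifert_splitting_iff[OF H] seifert_form_pair_iso_def form_isometry_def by blast
qed

end
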